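(* Let $V=(V^n,\Phi)$ be a Banach-Minkowski space of dimension $n\ge 3$, and let $\mathcal U\subset\operatorname{Gr}_2(V)$ be a connected open set such that for all $H,H'\in\mathcal U$ the normed planes $(H,\Phi|_H)$ and $(H',\Phi|_{H'})$ are isometric. Then $\Phi|_H$ is a Euclidean norm for every $H\in\mathcal U$. Moreover, there exists a Euclidean norm on $V$ whose restriction to every plane $H\in\mathcal U$ coincides with $\Phi|_H$.
   Context: $\operatorname{Gr}_2(V)$ is the Grassmannian of two-dimensional linear subspaces of $V$. A norm on a real vector space $V$ is a function $\Phi\colon V\to[0,\infty)$ that is subadditive, positive on $V\setminus\{0\}$, and positively homogeneous ($\Phi(\lambda v)=\lambda\Phi(v)$ for $\lambda>0$); it is not required to be symmetric. A Banach-Minkowski norm is a norm that is $C^\infty$ on $V\setminus\{0\}$ and such that $\Phi^2$ is quadratically strictly convex (its second differential is positive definite at every $v\ne 0$). A Banach-Minkowski space is a finite-dimensional real vector space with a Banach-Minkowski norm. A norm is Euclidean if it is associated with an inner product. Normed planes are isometric if there is a norm-preserving linear bijection between them. *)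

theory Defs
  imports "HOL-Analysis.Analysis"
begin

definition nonsymmetric_norm :: "('a::real_vector \<Rightarrow> real) \<Rightarrow> bool" where
  "nonsymmetric_norm \<Phi> \<longleftrightarrow>
     (\<forall>v. 0 \<le> \<Phi> v) \<and>
     (\<forall>v w. \<Phi> (v + w) \<le> \<Phi> v + \<Phi> w) \<and>
     (\<forall>v. v \<noteq> 0 \<longrightarrow> 0 < \<Phi> v) \<and>
     (\<forall>c v. 0 < c \<longrightarrow> \<Phi> (c *\<^sub>R v) = c * \<Phi> v)"

text \<open>For open \<open>S\<close>, \<open>Ck_on k S f\<close> says that \<open>f\<close> is \<open>k\<close> times continuously differentiable on \<open>S\<close>;
  in finite dimension it is enough to differentiate each directional derivative separately.\<close>

primrec Ck_on :: "nat \<Rightarrow> 'a::euclidean_space set \<Rightarrow> ('a \<Rightarrow> real) \<Rightarrow> bool" where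
  "Ck_on 0 S f \<longleftrightarrow> continuous_on S f"
| "Ck_on (Suc k) S f \<longleftrightarrow>
     (\<forall>x\<in>S. f differentiable (at x)) \<and> (\<forall>u. Ck_on k S (\<lambda>x. frechet_derivative f (at x) u))"

definition smooth_on :: "'a::euclidean_space set \<Rightarrow> ('a \<Rightarrow> real) \<Rightarrow> bool" where
  "smooth_on S f \<longleftrightarrow> (\<forall>k. Ck_on k S f)"

definition second_differential :: "('a::euclidean_space \<Rightarrow> real) \<Rightarrow> 'a \<Rightarrow> 'a \<Rightarrow> 'a \<Rightarrow> real" where
  "second_differential f x u w =
     frechet_derivative (\<lambda>y. frechet_derivative f (at y) u) (at x) w"

definition banach_minkowski_norm :: "('a::euclidean_space \<Rightarrow> real) \<Rightarrow> bool" where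
  "banach_minkowski_norm \<Phi> \<longleftrightarrow>
     nonsymmetric_norm \<Phi> \<and>
     smooth_on (UNIV - {0}) \<Phi> \<and>
     (\<forall>v. v \<noteq> 0 \<longrightarrow> (\<forall>u. u \<noteq> 0 \<longrightarrow> 0 < second_differential (\<lambda>x. (\<Phi> x)\<^sup>2) v u u))"

definition gr2 :: "'a::euclidean_space set set" where
  "gr2 = {H. subspace H \<and> dim H = 2}"

definition frames2 :: "('a::euclidean_space \<times> 'a) set" where
  "frames2 = {(v, w). v \<noteq> w \<and> independent {v, w}}"

definition frame_span :: "'a::euclidean_space \<times> 'a \<Rightarrow> 'a set" where
  "frame_span p = span {fst p, snd p}"

text \<open>The Grassmannian carries the quotient topology of the space of linearly independent pairs
  under \<open>(v, w) \<mapsto> span {v, w}\<close>; see \<open>quotient_map_gr2\<close> below.\<close>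

definition gr2_topology :: "'a::euclidean_space set topology" where
  "gr2_topology =
     topology (\<lambda>U. U \<subseteq> gr2 \<and> openin (top_of_set frames2) {p \<in> frames2. frame_span p \<in> U})"

lemma openin_gr2_topology:
  "openin gr2_topology U \<longleftrightarrow>
     U \<subseteq> gr2 \<and> openin (top_of_set frames2) {p \<in> frames2. frame_span p \<in> U}"
proof -
  have "istopology (\<lambda>U. U \<subseteq> gr2 \<and>
      openin (top_of_set (frames2 :: ('a \<times> 'a) set)) {p \<in> frames2. frame_span p \<in> U})"
    unfolding istopology_def
  proof (intro conjI allI impI)
    fix S T :: "'a set set"
    assume S: "S \<subseteq> gr2 \<and> openin (top_of_set frames2) {p \<in> frames2. frame_span p \<in> S}"
      and T: "T \<subseteq> gr2 \<and> openin (top_of_set frames2) {p \<in> frames2. frame_span p \<in> T}"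
    show "S \<inter> T \<subseteq> gr2" using S by blast
    have "{p \<in> frames2. frame_span p \<in> S \<inter> T} =
      {p \<in> frames2. frame_span p \<in> S} \<inter> {p \<in> frames2. frame_span p \<in> T}" by blast
    then show "openin (top_of_set frames2) {p \<in> frames2. frame_span p \<in> S \<inter> T}"
      using S T by (simp only: openin_Int)
  next
    fix K :: "'a set set set"
    assume K: "\<forall>S\<in>K. S \<subseteq> gr2 \<and> openin (top_of_set frames2) {p \<in> frames2. frame_span p \<in> S}"
    show "\<Union>K \<subseteq> gr2" using K by blast
    have "{p \<in> frames2. frame_span p \<in> \<Union>K} =
      \<Union>((\<lambda>S. {p \<in> frames2. frame_span p \<in> S}) ` K)" by blast
    then show "openin (top_of_set frames2) {p \<in> frames2. frame_span p \<in> \<Union>K}"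
      using K by (simp only:) (rule openin_Union, blast)
  qed
  then show ?thesis by (simp add: gr2_topology_def topology_inverse')
qed

lemma frame_span_image: "frame_span ` frames2 = (gr2 :: 'a::euclidean_space set set)"
proof (intro equalityI subsetI)
  fix H :: "'a set" assume "H \<in> frame_span ` frames2"
  then obtain v w where "v \<noteq> w" "independent {v, w}" "H = span {v, w}"
    by (auto simp: frames2_def frame_span_def)
  then show "H \<in> gr2" by (simp add: gr2_def dim_eq_card_independent)
next
  fix H :: "'a set" assume H: "H \<in> gr2"
  then obtain B where B: "B \<subseteq> H" "independent B" "H \<subseteq> span B" "card B = 2"
    using basis_exists[of H] by (auto simp: gr2_def)
  then obtain v w where vw: "B = {v, w}" "v \<noteq> w" by (auto simp: card_2_iff)
  have "span B \<subseteq> H" using B(1) H by (intro span_minimal) (auto simp: gr2_def)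
  with B(3) have "H = span B" by (rule subset_antisym)
  with vw B have "(v, w) \<in> frames2" "H = frame_span (v, w)"
    by (auto simp: frames2_def frame_span_def)
  then show "H \<in> frame_span ` frames2" by blast
qed

lemma topspace_gr2_topology: "topspace gr2_topology = (gr2 :: 'a::euclidean_space set set)"
proof -
  have "{p \<in> frames2. frame_span p \<in> (gr2 :: 'a set set)} = frames2"
    using frame_span_image by blast
  then have "openin gr2_topology (gr2 :: 'a set set)"
    by (simp add: openin_gr2_topology)
  moreover have "topspace gr2_topology \<subseteq> (gr2 :: 'a set set)"
    using openin_topspace[of gr2_topology] unfolding openin_gr2_topology by (rule conjunct1)
  ultimately show ?thesis by (intro subset_antisym openin_subset)
qed

lemma quotient_map_gr2:
  "quotient_map (top_of_set frames2) (gr2_topology :: 'a::euclidean_space set topology) frame_span"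
  by (auto simp: quotient_map_def topspace_gr2_topology frame_span_image openin_gr2_topology)

text \<open>A linear map defined only on the subspace \<open>H\<close> extends to the whole space, so it is no
  restriction to let \<open>L\<close> be globally linear.\<close>

definition isometric_subspaces ::
    "('a::real_vector \<Rightarrow> real) \<Rightarrow> 'a set \<Rightarrow> 'a set \<Rightarrow> bool" where
  "isometric_subspaces \<Phi> H H' \<longleftrightarrow>
     (\<exists>L. linear L \<and> bij_betw L H H' \<and> (\<forall>v\<in>H. \<Phi> (L v) = \<Phi> v))"

definition inner_product_on :: "'a::real_vector set \<Rightarrow> ('a \<Rightarrow> 'a \<Rightarrow> real) \<Rightarrow> bool" where
  "inner_product_on H b \<longleftrightarrow>
     (\<forall>x\<in>H. \<forall>y\<in>H. b x y = b y x) \<and>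
     (\<forall>x\<in>H. \<forall>y\<in>H. \<forall>z\<in>H. b (x + y) z = b x z + b y z) \<and>
     (\<forall>c. \<forall>x\<in>H. \<forall>y\<in>H. b (c *\<^sub>R x) y = c * b x y) \<and>
     (\<forall>x\<in>H. x \<noteq> 0 \<longrightarrow> 0 < b x x)"

definition euclidean_norm_on :: "'a::real_vector set \<Rightarrow> ('a \<Rightarrow> real) \<Rightarrow> bool" where
  "euclidean_norm_on H \<Phi> \<longleftrightarrow>
     (\<exists>b. inner_product_on H b \<and> (\<forall>v\<in>H. \<Phi> v = sqrt (b v v)))"

end

(* Either Phi restricted to a plane H of U has an infinitesimal isometry, and then it is Euclidean, or
   the isometries from H to nearby planes have well-defined first variations.  In the latter case
   tilting H towards e in the direction of a functional l gives an endomorphism A of H, linear in l,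
   with dPhi_v(A v + l(v) e) = 0.  A cubic form on a plane has a zero, which forces A v = l(v) w, so
   dPhi_v(e + w) = 0 along H: the unit ball is supported along H by a cylinder.  If this holds for an
   open set of planes, the third derivative of Phi^2 vanishes along them, so Phi^2 is quadratic.

   Once Phi is Euclidean on all planes of U, Phi^2(w) = D^2(Phi^2)_v(w, w) / 2 whenever v and w span a
   plane of U.  Hence D^2(Phi^2) is locally constant on the union of these planes, and constant by
   connectedness; its value is the required inner product. *)

theory Submission
  imports Defs
begin

section \<open>Iterated directional derivatives\<close>

text \<open>The hypothesis gives some isometry for each pair of planes, with no continuity in the
  planes. First variations are therefore extracted by compactness: isometries from H onto planes
  tending to H are corrected by the inverse of a limit, and their difference quotients are rescaled
  so that a nonzero limit exists.

  The dichotomy is uniform on U, because being Euclidean passes along isometries: if one plane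
  fails, all do, and every plane of the open set U carries a cylinder. Differentiating the cylinder
  condition twice along H gives D^3(Phi^2)_v(N, u, u) = 0 for every N normal to H with respect to
  D^2(Phi^2)_v. This concerns a direction off H; tilting the plane about v inside U turns it into a
  statement about D^3(Phi^2)_v(u, u, u).

  The square is used because its second differential is a definite form that is constant on rays, so
  that D^3(Phi^2)_v vanishes as soon as one argument is v. Since Phi need not be symmetric, evenness
  on a plane must be derived too.\<close>

definition dd :: "('a::euclidean_space \<Rightarrow> real) \<Rightarrow> 'a \<Rightarrow> 'a \<Rightarrow> real" where
  "dd f u x = frechet_derivative f (at x) u"

lemma Ck_on_Suc_dd:
  "Ck_on (Suc k) S f \<longleftrightarrow> (\<forall>x\<in>S. f differentiable (at x)) \<and> (\<forall>u. Ck_on k S (dd f u))"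
  by (simp add: dd_def[abs_def])

lemma second_differential_dd: "second_differential f x u w = dd (dd f u) w x"
  by (simp add: second_differential_def dd_def[abs_def])

lemma smooth_on_differentiable: "smooth_on S f \<Longrightarrow> x \<in> S \<Longrightarrow> f differentiable (at x)"
  unfolding smooth_on_def using Ck_on_Suc_dd[of 0 S f] by blast

lemma smooth_on_dd: "smooth_on S f \<Longrightarrow> smooth_on S (dd f u)"
  unfolding smooth_on_def using Ck_on_Suc_dd[of _ S f] by blast

lemma smooth_on_continuous: "smooth_on S f \<Longrightarrow> continuous_on S f"
  unfolding smooth_on_def using Ck_on.simps(1)[of S f] by blast

lemma dd_has_derivative:
  "f differentiable (at x) \<Longrightarrow> (f has_derivative (\<lambda>u. dd f u x)) (at x)"
  by (simp add: dd_def frechet_derivative_works[symmetric])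

lemma has_derivative_dd: "(f has_derivative f') (at x) \<Longrightarrow> dd f u x = f' u"
  by (metis dd_def frechet_derivative_at)

lemma linear_dd: "f differentiable (at x) \<Longrightarrow> linear (\<lambda>u. dd f u x)"
  unfolding dd_def by (rule linear_frechet_derivative)

lemma has_derivative_cong_open:
  assumes "open S" "x \<in> S" "\<And>y. y \<in> S \<Longrightarrow> f y = g y" "(f has_derivative f') (at x)"
  shows "(g has_derivative f') (at x)"
  using has_derivative_transform_within_open[of f f' x UNIV S g] assms by simp

lemma dd_cong_open:
  assumes "open S" "x \<in> S" "\<And>y. y \<in> S \<Longrightarrow> f y = g y" "f differentiable (at x)"
  shows "dd f u x = dd g u x"
  using has_derivative_dd[OF has_derivative_cong_open[OF assms(1-3) dd_has_derivative[OF assms(4)]]]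
  by simp

text \<open>Rules such as the sum and product rule identify derivatives only at points of
  \<open>S\<close>; this transfers regularity across such identities, and openness is what makes the
  derivatives agree as well.\<close>

lemma Ck_on_cong_open:
  assumes "open S" "Ck_on k S f" "\<And>y. y \<in> S \<Longrightarrow> f y = g y"
  shows "Ck_on k S g"
  using assms(2,3)
proof (induction k arbitrary: f g)
  case 0
  then show ?case using continuous_on_cong by fastforce
next
  case (Suc k)
  have "g differentiable (at x)" if "x \<in> S" for x
    using Suc.prems that has_derivative_cong_open[OF assms(1) that, of f g]
    unfolding Ck_on_Suc_dd differentiable_def by blast
  moreover have "Ck_on k S (dd g u)" for u
  proof (rule Suc.IH)
    show "Ck_on k S (dd f u)" using Suc.prems unfolding Ck_on_Suc_dd by blast
    show "dd f u y = dd g u y" if "y \<in> S" for y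
      using Suc.prems that unfolding Ck_on_Suc_dd
      by (intro dd_cong_open[OF assms(1) that]) blast+
  qed
  ultimately show ?case unfolding Ck_on_Suc_dd by blast
qed

lemma Ck_on_Suc_imp: "Ck_on (Suc k) S f \<Longrightarrow> Ck_on k S f"
proof (induction k arbitrary: f)
  case 0
  then show ?case
    by (auto intro!: continuous_at_imp_continuous_on differentiable_imp_continuous_within)
next
  case (Suc k)
  then show ?case unfolding Ck_on_Suc_dd[of "Suc k"] Ck_on_Suc_dd[of k] by blast
qed

lemma Ck_on_add: "open S \<Longrightarrow> Ck_on k S f \<Longrightarrow> Ck_on k S g \<Longrightarrow> Ck_on k S (\<lambda>x. f x + g x)"
proof (induction k arbitrary: f g)
  case 0
  then show ?case by (simp add: continuous_on_add)
next
  case (Suc k)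
  have df: "f differentiable (at x)" "g differentiable (at x)" if "x \<in> S" for x
    using Suc.prems that unfolding Ck_on_Suc_dd by blast+
  have "Ck_on k S (dd (\<lambda>x. f x + g x) u)" for u
  proof (rule Ck_on_cong_open[OF Suc.prems(1)])
    show "Ck_on k S (\<lambda>x. dd f u x + dd g u x)"
      using Suc unfolding Ck_on_Suc_dd by blast
    show "dd f u y + dd g u y = dd (\<lambda>x. f x + g x) u y" if "y \<in> S" for y
      using has_derivative_dd[OF has_derivative_add[OF df(1)[OF that, THEN dd_has_derivative]
        df(2)[OF that, THEN dd_has_derivative]]] by simp
  qed
  then show ?case unfolding Ck_on_Suc_dd using df by (auto intro: differentiable_add)
qed

lemma Ck_on_mult: "open S \<Longrightarrow> Ck_on k S f \<Longrightarrow> Ck_on k S g \<Longrightarrow> Ck_on k S (\<lambda>x. f x * g x)"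
proof (induction k arbitrary: f g)
  case 0
  then show ?case by (simp add: continuous_on_mult)
next
  case (Suc k)
  have df: "f differentiable (at x)" "g differentiable (at x)" if "x \<in> S" for x
    using Suc.prems that unfolding Ck_on_Suc_dd by blast+
  have "Ck_on k S (dd (\<lambda>x. f x * g x) u)" for u
  proof (rule Ck_on_cong_open[OF Suc.prems(1)])
    show "Ck_on k S (\<lambda>x. f x * dd g u x + dd f u x * g x)"
    proof -
      have "Ck_on k S f" "Ck_on k S g" using Suc.prems by (blast dest: Ck_on_Suc_imp)+
      moreover have "Ck_on k S (dd f u)" "Ck_on k S (dd g u)"
        using Suc.prems unfolding Ck_on_Suc_dd by blast+
      ultimately show ?thesis using Suc.prems(1) Suc.IH by (intro Ck_on_add) auto
    qed
    show "f y * dd g u y + dd f u y * g y = dd (\<lambda>x. f x * g x) u y" if "y \<in> S" for y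
      using has_derivative_dd[OF has_derivative_mult[OF df(1)[OF that, THEN dd_has_derivative]
        df(2)[OF that, THEN dd_has_derivative]]] by simp
  qed
  then show ?case unfolding Ck_on_Suc_dd using df by (auto intro: differentiable_mult)
qed

lemma smooth_on_power2: "open S \<Longrightarrow> smooth_on S f \<Longrightarrow> smooth_on S (\<lambda>x. (f x)\<^sup>2)"
  unfolding smooth_on_def power2_eq_square using Ck_on_mult by blast

lemma dd_line:
  assumes "f differentiable (at (x + t *\<^sub>R u))"
  shows "((\<lambda>t. f (x + t *\<^sub>R u)) has_real_derivative dd f u (x + t *\<^sub>R u)) (at t)"
proof -
  have "((\<lambda>t. x + t *\<^sub>R u) has_derivative (\<lambda>h. h *\<^sub>R u)) (at t)"
    by (auto intro!: derivative_eq_intros)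
  from diff_chain_at[OF this dd_has_derivative[OF assms]]
  have "((\<lambda>t. f (x + t *\<^sub>R u)) has_derivative (\<lambda>h. dd f (h *\<^sub>R u) (x + t *\<^sub>R u))) (at t)"
    by (simp add: o_def)
  moreover have "(\<lambda>h. dd f (h *\<^sub>R u) (x + t *\<^sub>R u)) = (*) (dd f u (x + t *\<^sub>R u))"
    using linear_dd[OF assms] by (auto simp: linear_iff)
  ultimately show ?thesis
    by (simp add: has_field_derivative_def)
qed

text \<open>The mean value theorem is applied twice, in direction \<open>u\<close> and then in
  direction \<open>w\<close>. The second difference is symmetric in \<open>u\<close> and
  \<open>w\<close>, while the derivative on the right is not visibly so; this is the source of the
  symmetry of second derivatives.\<close>

lemma second_difference_mvt:
  assumes f: "smooth_on S f" and r: "ball x r \<subseteq> S" and h: "0 < h" "h * (norm u + norm w) < r"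
  obtains p where "dist x p \<le> h * (norm u + norm w)" "p \<in> S"
    "f (x + h *\<^sub>R u + h *\<^sub>R w) - f (x + h *\<^sub>R u) - f (x + h *\<^sub>R w) + f x = h^2 * dd (dd f u) w p"
proof -
  have d: "dist x (x + s *\<^sub>R u + t *\<^sub>R w) \<le> h * (norm u + norm w)"
    if "0 \<le> s" "s \<le> h" "0 \<le> t" "t \<le> h" for s t
  proof -
    have "norm (s *\<^sub>R u + t *\<^sub>R w) \<le> norm (s *\<^sub>R u) + norm (t *\<^sub>R w)" by (rule norm_triangle_ineq)
    also have "\<dots> \<le> h * norm u + h * norm w"
      using that by (auto intro!: add_mono mult_right_mono)
    finally show ?thesis by (simp add: dist_norm norm_minus_commute algebra_simps)
  qed
  have inS: "x + s *\<^sub>R u + t *\<^sub>R w \<in> S" if "0 \<le> s" "s \<le> h" "0 \<le> t" "t \<le> h" for s t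
    using d[OF that] h r by (metis less_eq_real_def mem_ball order_le_less_trans subsetD)
  define g where "g s = f (x + h *\<^sub>R w + s *\<^sub>R u) - f (x + s *\<^sub>R u)" for s
  have "\<exists>z. 0 < z \<and> z < h \<and>
      g h - g 0 = (h - 0) * (dd f u (x + h *\<^sub>R w + z *\<^sub>R u) - dd f u (x + z *\<^sub>R u))"
  proof (rule MVT2[OF h(1)])
    fix s assume s: "0 \<le> s" "s \<le> h"
    show "(g has_real_derivative dd f u (x + h *\<^sub>R w + s *\<^sub>R u) - dd f u (x + s *\<^sub>R u)) (at s)"
      unfolding g_def
      using inS[of s h] inS[of s 0] s h
      by (intro DERIV_diff dd_line smooth_on_differentiable[OF f]) (auto simp: algebra_simps)
  qed
  then obtain z where z: "0 < z" "z < h"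
    "g h - g 0 = h * (dd f u (x + h *\<^sub>R w + z *\<^sub>R u) - dd f u (x + z *\<^sub>R u))" by auto
  have "\<exists>y. 0 < y \<and> y < h \<and>
      dd f u (x + z *\<^sub>R u + h *\<^sub>R w) - dd f u (x + z *\<^sub>R u + 0 *\<^sub>R w) =
      (h - 0) * dd (dd f u) w (x + z *\<^sub>R u + y *\<^sub>R w)"
  proof (rule MVT2[OF h(1)])
    fix s assume s: "0 \<le> s" "s \<le> h"
    show "((\<lambda>s. dd f u (x + z *\<^sub>R u + s *\<^sub>R w)) has_real_derivative
        dd (dd f u) w (x + z *\<^sub>R u + s *\<^sub>R w)) (at s)"
      using inS[of z s] s z
      by (intro dd_line smooth_on_differentiable[OF smooth_on_dd[OF f]]) auto
  qed
  then obtain y where y: "0 < y" "y < h"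
    "dd f u (x + z *\<^sub>R u + h *\<^sub>R w) - dd f u (x + z *\<^sub>R u) =
      h * dd (dd f u) w (x + z *\<^sub>R u + y *\<^sub>R w)" by auto
  have "f (x + h *\<^sub>R u + h *\<^sub>R w) - f (x + h *\<^sub>R u) - f (x + h *\<^sub>R w) + f x = g h - g 0"
    by (simp add: g_def algebra_simps)
  also have "\<dots> = h^2 * dd (dd f u) w (x + z *\<^sub>R u + y *\<^sub>R w)"
    using z(3) y(3) by (simp add: algebra_simps power2_eq_square)
  finally show ?thesis using that d[of z y] inS[of z y] z y by auto
qed

text \<open>Both orders of differentiation represent the same second difference, at intermediate
  points \<open>p n\<close> and \<open>q n\<close> that converge to \<open>x\<close>; continuity of
  the second derivatives finishes.\<close>

lemma dd_dd_commute:
  assumes S: "open S" and f: "smooth_on S f" and x: "x \<in> S"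
  shows "dd (dd f u) w x = dd (dd f w) u x"
proof -
  obtain r where r: "0 < r" "ball x r \<subseteq> S" using S x open_contains_ball by blast
  define c where "c = norm u + norm w"
  have c: "0 \<le> c" by (simp add: c_def)
  \<comment> \<open>The denominator \<open>2 * (1 + c)\<close> keeps the parallelograms inside the
    ball and is nonzero even for \<open>c = 0\<close>.\<close>
  define h where "h n = r / (2 * (1 + c)) / real (Suc n)" for n
  have h0: "0 < h n" for n using r c by (simp add: h_def add_nonneg_pos)
  have hl: "h n * c < r" for n
  proof -
    have "h n * c \<le> r / (2 * (1 + c)) * c"
      unfolding h_def using r c frac_le[of "r / (2 * (1 + c))" "r / (2 * (1 + c))" 1 "real (Suc n)"]
      by (intro mult_right_mono) auto
    also have "\<dots> < r" using r c by (simp add: divide_less_eq add_nonneg_pos algebra_simps)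
    finally show ?thesis .
  qed
  have "\<exists>p. dist x p \<le> h n * c \<and> p \<in> S \<and> f (x + h n *\<^sub>R u + h n *\<^sub>R w) - f (x + h n *\<^sub>R u)
      - f (x + h n *\<^sub>R w) + f x = (h n)^2 * dd (dd f u) w p" for n
    using second_difference_mvt[OF f r(2) h0[of n], of u w] hl[of n] unfolding c_def by metis
  then obtain p where p: "\<And>n. dist x (p n) \<le> h n * c" "\<And>n. p n \<in> S"
    "\<And>n. f (x + h n *\<^sub>R u + h n *\<^sub>R w) - f (x + h n *\<^sub>R u)
      - f (x + h n *\<^sub>R w) + f x = (h n)^2 * dd (dd f u) w (p n)" by metis
  have "\<exists>p. dist x p \<le> h n * c \<and> p \<in> S \<and> f (x + h n *\<^sub>R w + h n *\<^sub>R u) - f (x + h n *\<^sub>R w)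
      - f (x + h n *\<^sub>R u) + f x = (h n)^2 * dd (dd f w) u p" for n
    using second_difference_mvt[OF f r(2) h0[of n], of w u] hl[of n] unfolding c_def
    by (metis add.commute)
  then obtain q where q: "\<And>n. dist x (q n) \<le> h n * c" "\<And>n. q n \<in> S"
    "\<And>n. f (x + h n *\<^sub>R w + h n *\<^sub>R u) - f (x + h n *\<^sub>R w)
      - f (x + h n *\<^sub>R u) + f x = (h n)^2 * dd (dd f w) u (q n)" by metis
  have eq: "dd (dd f u) w (p n) = dd (dd f w) u (q n)" for n
  proof -
    have "(h n)^2 * dd (dd f u) w (p n) = (h n)^2 * dd (dd f w) u (q n)"
      unfolding p(3)[symmetric] q(3)[symmetric] by (simp add: algebra_simps)
    then show ?thesis using h0[of n] by simp
  qed
  have "(\<lambda>n. h n * c) \<longlonglongrightarrow> r / (2 * (1 + c)) * 0 * c"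
    unfolding h_def divide_inverse[of _ "real (Suc _)"]
    by (intro tendsto_intros LIMSEQ_inverse_real_of_nat)
  then have h_lim: "(\<lambda>n. h n * c) \<longlonglongrightarrow> 0" by simp
  have lim: "s \<longlonglongrightarrow> x" if "\<And>n. dist x (s n) \<le> h n * c" for s
    using h_lim that unfolding tendsto_dist_iff[of s]
    by (intro tendsto_sandwich[OF _ _ tendsto_const h_lim]) (auto simp: dist_commute)
  have "(\<lambda>n. dd (dd f u) w (p n)) \<longlonglongrightarrow> dd (dd f u) w x"
    using smooth_on_continuous[OF smooth_on_dd[OF smooth_on_dd[OF f]]] lim[OF p(1)] p(2) x
    by (auto simp: continuous_on_sequentially o_def)
  moreover have "(\<lambda>n. dd (dd f w) u (q n)) \<longlonglongrightarrow> dd (dd f w) u x"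
    using smooth_on_continuous[OF smooth_on_dd[OF smooth_on_dd[OF f]]] lim[OF q(1)] q(2) x
    by (auto simp: continuous_on_sequentially o_def)
  ultimately show ?thesis unfolding eq using LIMSEQ_unique by blast
qed

lemma linear_dd_dd:
  assumes S: "open S" and f: "smooth_on S f" and x: "x \<in> S"
  shows "linear (\<lambda>u. dd (dd f u) w x)" "linear (\<lambda>w. dd (dd f u) w x)"
proof -
  show 1: "linear (\<lambda>w. dd (dd f u) w x)" for u
    by (intro linear_dd smooth_on_differentiable[OF smooth_on_dd[OF f] x])
  have "(\<lambda>u. dd (dd f u) w x) = (\<lambda>u. dd (dd f w) u x)"
    using dd_dd_commute[OF assms] by blast
  with 1 show "linear (\<lambda>u. dd (dd f u) w x)" by simp
qed

text \<open>Differentiability gives linearity in the direction differentiated last; symmetry moves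
  \<open>u\<close> to that place.\<close>

lemma linear_dd_dd_dd:
  assumes S: "open S" and f: "smooth_on S f" and x: "x \<in> S"
  shows "linear (\<lambda>u. dd (dd (dd f u) w) z x)"
proof -
  have "(\<lambda>u. dd (dd (dd f u) w) z x) = (\<lambda>u. dd (dd (dd f w) z) u x)"
  proof
    fix u
    have "dd (dd (dd f u) w) z x = dd (dd (dd f w) u) z x"
      using dd_dd_commute[OF S f] smooth_on_differentiable[OF smooth_on_dd[OF smooth_on_dd[OF f]]] x
      by (intro dd_cong_open[OF S x]) auto
    also have "\<dots> = dd (dd (dd f w) z) u x"
      by (rule dd_dd_commute[OF S smooth_on_dd[OF f] x])
    finally show "dd (dd (dd f u) w) z x = dd (dd (dd f w) z) u x" .
  qed
  then show ?thesis using linear_dd_dd(2)[OF S smooth_on_dd[OF f] x] by simp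
qed

lemma dd_dd_dd_commute:
  assumes S: "open S" and f: "smooth_on S f" and x: "x \<in> S"
  shows "dd (dd (dd f u) w) z x = dd (dd (dd f w) u) z x"
    and "dd (dd (dd f u) w) z x = dd (dd (dd f u) z) w x"
proof -
  show "dd (dd (dd f u) w) z x = dd (dd (dd f w) u) z x"
    using dd_dd_commute[OF S f] smooth_on_differentiable[OF smooth_on_dd[OF smooth_on_dd[OF f]]] x
    by (intro dd_cong_open[OF S x]) auto
  show "dd (dd (dd f u) w) z x = dd (dd (dd f u) z) w x"
    by (rule dd_dd_commute[OF S smooth_on_dd[OF f] x])
qed

section \<open>Derivatives read off along a line\<close>

lemma dd_zero_along:
  assumes f: "f differentiable (at x)" and \<delta>: "0 < \<delta>" "\<And>t. \<bar>t\<bar> < \<delta> \<Longrightarrow> f (x + t *\<^sub>R u) = c"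
  shows "dd f u x = 0"
proof -
  have d: "((\<lambda>t. f (x + t *\<^sub>R u)) has_real_derivative dd f u x) (at 0)"
    using dd_line[of f x 0 u] f by simp
  have "((\<lambda>t. c) has_real_derivative dd f u x) (at 0)"
    by (rule has_field_derivative_transform_within_open[OF d, of "ball 0 \<delta>"])
      (use \<delta> in \<open>auto simp: dist_real_def\<close>)
  then show ?thesis using DERIV_const DERIV_unique by blast
qed

text \<open>This is the source of the identities \<Phi>(z)^2 = D^2(\<Phi>^2)_v(z, z) / 2: the
  squared norm is expanded along v + t z and the coefficient of t^2 is compared. A short segment
  suffices, which matters when the expansion is only known for small t.\<close>

lemma dd_dd_quadratic:
  assumes S: "open S" and f: "smooth_on S f" and x: "x \<in> S"
    and \<delta>: "0 < \<delta>" "\<And>t. \<bar>t\<bar> < \<delta> \<Longrightarrow> f (x + t *\<^sub>R u) = a + b * t + c * t\<^sup>2"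
  shows "dd (dd f u) u x = 2 * c"
proof -
  have "open ((\<lambda>t. x + t *\<^sub>R u) -` S)"
    by (intro continuous_open_vimage S) (auto intro!: continuous_intros)
  moreover have "0 \<in> (\<lambda>t. x + t *\<^sub>R u) -` S" using x by simp
  ultimately obtain r where r: "0 < r" "ball 0 r \<subseteq> (\<lambda>t. x + t *\<^sub>R u) -` S"
    using open_contains_ball by metis
  define m where "m = min r \<delta>"
  have m: "0 < m" "m \<le> \<delta>" using r \<delta> by (auto simp: m_def)
  have inS: "x + t *\<^sub>R u \<in> S" if "\<bar>t\<bar> < m" for t
    using r(2) that by (auto simp: m_def subset_iff dist_real_def)
  have first: "dd f u (x + t *\<^sub>R u) = b + 2 * c * t" if t: "\<bar>t\<bar> < m" for t
  proof -
    have "((\<lambda>t. a + b * t + c * t\<^sup>2) has_real_derivative dd f u (x + t *\<^sub>R u)) (at t)"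
      by (rule has_field_derivative_transform_within_open
          [OF dd_line[OF smooth_on_differentiable[OF f inS[OF t]]], of "ball 0 m"])
        (use t m \<delta> in \<open>auto simp: dist_real_def\<close>)
    moreover have "((\<lambda>t. a + b * t + c * t\<^sup>2) has_real_derivative b + 2 * c * t) (at t)"
      by (auto intro!: derivative_eq_intros)
    ultimately show ?thesis by (rule DERIV_unique)
  qed
  have "dd f u differentiable (at (x + 0 *\<^sub>R u))"
    using smooth_on_differentiable[OF smooth_on_dd[OF f] x] by simp
  from dd_line[OF this] have d: "((\<lambda>t. dd f u (x + t *\<^sub>R u)) has_real_derivative dd (dd f u) u x) (at 0)"
    by simp
  have "((\<lambda>t. b + 2 * c * t) has_real_derivative dd (dd f u) u x) (at 0)"
    by (rule has_field_derivative_transform_within_open[OF d, of "ball 0 m"])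
      (use m first in \<open>auto simp: dist_real_def\<close>)
  moreover have "((\<lambda>t. b + 2 * c * t) has_real_derivative 2 * c) (at 0)"
    by (auto intro!: derivative_eq_intros)
  ultimately show ?thesis by (rule DERIV_unique)
qed

text \<open>The chain rule applied to a homogeneity relation. The factor \<open>k\<close> will be
  \<open>c\<^sup>2\<close> for the squared norm and \<open>c\<close> for its first
  derivatives.\<close>

lemma dd_scaled:
  fixes c :: real
  assumes S: "open S" and x: "x \<in> S" and f: "f differentiable (at x)" "f differentiable (at (c *\<^sub>R x))"
    and hom: "\<And>y. y \<in> S \<Longrightarrow> f (c *\<^sub>R y) = k * f y"
  shows "c * dd f u (c *\<^sub>R x) = k * dd f u x"
proof -
  have "((\<lambda>y. c *\<^sub>R y) has_derivative (\<lambda>h. c *\<^sub>R h)) (at x)"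
    by (auto intro!: derivative_eq_intros)
  from diff_chain_at[OF this dd_has_derivative[OF f(2)]]
  have "((\<lambda>y. f (c *\<^sub>R y)) has_derivative (\<lambda>h. dd f (c *\<^sub>R h) (c *\<^sub>R x))) (at x)"
    by (simp add: o_def)
  from has_derivative_cong_open[OF S x hom this]
  have "dd (\<lambda>y. k * f y) u x = dd f (c *\<^sub>R u) (c *\<^sub>R x)"
    by (auto intro: has_derivative_dd)
  moreover have "dd (\<lambda>y. k * f y) u x = k * dd f u x"
    by (intro has_derivative_dd has_derivative_mult_right dd_has_derivative f)
  ultimately show ?thesis using linear_dd[OF f(2)] by (simp add: linear_iff)
qed

lemma eq_on_line_if_third_derivative_zero:
  fixes f f' f'' :: "real \<Rightarrow> real"
  assumes 1: "\<And>t. (f has_real_derivative f' t) (at t)"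
    and 2: "\<And>t. (f' has_real_derivative f'' t) (at t)"
    and 3: "\<And>t. (f'' has_real_derivative 0) (at t)"
  shows "f t = f 0 + f' 0 * t + f'' 0 / 2 * t\<^sup>2"
proof -
  have c: "f'' t = f'' 0" for t
    using DERIV_isconst_all[of f''] 3 by blast
  have "((\<lambda>t. f' t - f'' 0 * t) has_real_derivative 0) (at t)" for t
    using 2[of t] c[of t] by (auto intro!: derivative_eq_intros)
  then have l: "f' t = f' 0 + f'' 0 * t" for t
    using DERIV_isconst_all[of "\<lambda>t. f' t - f'' 0 * t" t 0] by simp
  have "((\<lambda>t. f t - f' 0 * t - f'' 0 / 2 * t\<^sup>2) has_real_derivative 0) (at t)" for t
    using 1[of t] l[of t] by (auto intro!: derivative_eq_intros)
  then show ?thesis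
    using DERIV_isconst_all[of "\<lambda>t. f t - f' 0 * t - f'' 0 / 2 * t\<^sup>2" t 0] by simp
qed

section \<open>Frames of planes\<close>

lemma mem_span2: "z \<in> span {v, w} \<longleftrightarrow> (\<exists>a b. z = a *\<^sub>R v + b *\<^sub>R w)"
proof
  assume "z \<in> span {v, w}"
  then obtain a where "z - a *\<^sub>R v \<in> span {w}" by (auto simp: span_breakdown_eq)
  then obtain b where "z - a *\<^sub>R v = b *\<^sub>R w" by (auto simp: span_singleton)
  then have "z = a *\<^sub>R v + b *\<^sub>R w" by (simp add: algebra_simps)
  then show "\<exists>a b. z = a *\<^sub>R v + b *\<^sub>R w" by blast
next
  assume "\<exists>a b. z = a *\<^sub>R v + b *\<^sub>R w"
  then obtain a b where "z = a *\<^sub>R v + b *\<^sub>R w" by blast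
  then show "z \<in> span {v, w}" by (simp add: span_add span_scale span_base)
qed

lemma mem_frames2: "(v, w) \<in> frames2 \<longleftrightarrow> v \<noteq> 0 \<and> (\<forall>c. w \<noteq> c *\<^sub>R v)"
proof -
  have "v \<noteq> w \<and> independent {v, w} \<longleftrightarrow> v \<noteq> 0 \<and> w \<notin> span {v}"
    using independent_insert[of w "{v}"]
    by (auto simp: insert_commute[of v w] dependent_single span_base)
  then show ?thesis by (auto simp: frames2_def span_singleton)
qed

lemma frames2_nonzero: "(v, w) \<in> frames2 \<Longrightarrow> v \<noteq> 0 \<and> w \<noteq> 0"
  by (metis mem_frames2 scale_zero_left)

lemma frames2_coords:
  assumes "(v, w) \<in> frames2" "a *\<^sub>R v + b *\<^sub>R w = 0"
  shows "a = 0 \<and> b = 0"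
proof -
  have "b = 0"
  proof (rule ccontr)
    assume b: "b \<noteq> 0"
    have "b *\<^sub>R w = (- a) *\<^sub>R v" using assms(2) by (simp add: add_eq_0_iff)
    then have "(1 / b) *\<^sub>R (b *\<^sub>R w) = (- a / b) *\<^sub>R v" by (metis divide_inverse inverse_eq_divide mult.commute scaleR_scaleR)
    then have "w = (- a / b) *\<^sub>R v" using b by simp
    then show False using assms(1) mem_frames2 by blast
  qed
  then show ?thesis using assms frames2_nonzero[OF assms(1)] by simp
qed

lemma frames2_coords_eq:
  assumes "(v, w) \<in> frames2" "a *\<^sub>R v + b *\<^sub>R w = a' *\<^sub>R v + b' *\<^sub>R w"
  shows "a = a' \<and> b = b'"
  using frames2_coords[OF assms(1), of "a - a'" "b - b'"] assms(2) by (simp add: algebra_simps)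

lemma frames2_comb:
  assumes "(v, w) \<in> frames2" "a * d - b * c \<noteq> 0"
  shows "(a *\<^sub>R v + b *\<^sub>R w, c *\<^sub>R v + d *\<^sub>R w) \<in> frames2"
  unfolding mem_frames2
proof (intro conjI allI notI)
  assume "a *\<^sub>R v + b *\<^sub>R w = 0"
  then show False using frames2_coords[OF assms(1), of a b] assms(2) by auto
next
  fix k assume "c *\<^sub>R v + d *\<^sub>R w = k *\<^sub>R (a *\<^sub>R v + b *\<^sub>R w)"
  then have "c *\<^sub>R v + d *\<^sub>R w = (k * a) *\<^sub>R v + (k * b) *\<^sub>R w" by (simp add: algebra_simps)
  from frames2_coords_eq[OF assms(1) this] show False using assms(2) by simp
qed

lemma frames2_swap: "(v, w) \<in> frames2 \<Longrightarrow> (w, v) \<in> frames2"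
  using frames2_comb[of v w 0 0 1 1] by simp

lemma frame_span_in_gr2: "(v, w) \<in> frames2 \<Longrightarrow> span {v, w} \<in> gr2"
proof -
  assume "(v, w) \<in> frames2"
  then have "frame_span (v, w) \<in> frame_span ` frames2" by (rule imageI)
  then show ?thesis unfolding frame_span_image by (simp add: frame_span_def)
qed

lemma gr2_obtain_frame:
  assumes "H \<in> gr2"
  obtains v w where "(v, w) \<in> frames2" "H = span {v, w}"
proof -
  have "H \<in> frame_span ` frames2" using assms unfolding frame_span_image .
  then obtain v w where "H = frame_span (v, w)" "(v, w) \<in> frames2" by (rule imageE) (metis prod.collapse)
  then show ?thesis using that by (simp add: frame_span_def)
qed

lemma gr2_subspace: "H \<in> gr2 \<Longrightarrow> subspace H"
  by (simp add: gr2_def)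

lemma frame_span_eq:
  assumes H: "H \<in> gr2" and vw: "(v, w) \<in> frames2" "v \<in> H" "w \<in> H"
  shows "span {v, w} = H"
proof (rule subspace_dim_equal)
  show "span {v, w} \<subseteq> H" using vw H by (intro span_minimal) (auto simp: gr2_def)
  show "dim H \<le> dim (span {v, w})" using H frame_span_in_gr2[OF vw(1)] by (simp add: gr2_def)
qed (use H in \<open>auto simp: gr2_def\<close>)

lemma gr2_extend_frame:
  assumes "H \<in> gr2" "v \<in> H" "v \<noteq> 0"
  obtains w where "w \<in> H" "(v, w) \<in> frames2"
proof -
  obtain w where "w \<in> H" "\<forall>c. w \<noteq> c *\<^sub>R v"
  proof (rule ccontr)
    assume "\<not> thesis"
    then have "H \<subseteq> span {v}" using that by (auto simp: span_singleton)
    then have "dim H \<le> 1" using dim_subset[of H "span {v}"] dim_le_card[of "span {v}" "{v}"] by simp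
    then show False using assms(1) by (simp add: gr2_def)
  qed
  then show ?thesis using that assms(3) mem_frames2 by blast
qed

text \<open>Linear independence is strictness in the Cauchy-Schwarz inequality, an open condition on
  the pair.\<close>

lemma open_frames2: "open (frames2 :: ('a::euclidean_space \<times> 'a) set)"
proof -
  have "(v, w) \<in> frames2 \<longleftrightarrow> (v \<bullet> w)\<^sup>2 - (v \<bullet> v) * (w \<bullet> w) < 0" for v w :: 'a
  proof (cases "v = 0")
    case True
    then show ?thesis using frames2_nonzero[of v w] by auto
  next
    case False
    \<comment> \<open>Up to the factor \<open>v \<bullet> v\<close> this is the component of
      \<open>w\<close> orthogonal to \<open>v\<close>; its square is \<open>v \<bullet> v\<close>
      times the Gram determinant.\<close>
    define z where "z = (v \<bullet> v) *\<^sub>R w - (v \<bullet> w) *\<^sub>R v"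
    have vv: "v \<bullet> v > 0" using False by simp
    have "z \<bullet> z = (v \<bullet> v) * ((v \<bullet> v) * (w \<bullet> w) - (v \<bullet> w)\<^sup>2)"
      by (simp add: z_def inner_diff_left inner_diff_right inner_commute algebra_simps power2_eq_square)
    then have "z \<noteq> 0 \<longleftrightarrow> (v \<bullet> v) * (w \<bullet> w) - (v \<bullet> w)\<^sup>2 > 0"
      using vv by (metis inner_gt_zero_iff zero_less_mult_pos zero_less_mult_iff)
    moreover have "z = 0 \<longleftrightarrow> (\<exists>c. w = c *\<^sub>R v)"
    proof
      assume "z = 0"
      then have "(1 / (v \<bullet> v)) *\<^sub>R ((v \<bullet> v) *\<^sub>R w) = ((v \<bullet> w) / (v \<bullet> v)) *\<^sub>R v"
        by (simp add: z_def)
      then have "w = ((v \<bullet> w) / (v \<bullet> v)) *\<^sub>R v" using vv by simp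
      then show "\<exists>c. w = c *\<^sub>R v" by blast
    qed (auto simp: z_def)
    ultimately show ?thesis using False by (auto simp: mem_frames2)
  qed
  then have "(frames2 :: ('a \<times> 'a) set) =
      {p. (fst p \<bullet> snd p)\<^sup>2 - (fst p \<bullet> fst p) * (snd p \<bullet> snd p) < 0}" by auto
  also have "open \<dots>" by (intro open_Collect_less continuous_intros)
  finally show ?thesis .
qed

lemma openin_gr2_iff:
  "openin gr2_topology U \<longleftrightarrow> U \<subseteq> gr2 \<and> open {p \<in> frames2. frame_span p \<in> U}"
  using openin_open_eq[OF open_frames2] by (auto simp: openin_gr2_topology)

lemma openin_gr2_ball:
  assumes "openin gr2_topology U" "(v, w) \<in> frames2" "span {v, w} \<in> U"
  obtains \<delta> where "0 < \<delta>"
    "\<And>v' w'. dist (v', w') (v, w) < \<delta> \<Longrightarrow> (v', w') \<in> frames2 \<and> span {v', w'} \<in> U"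
proof -
  have "open {p \<in> frames2. frame_span p \<in> U}" using assms openin_gr2_iff by blast
  moreover have "(v, w) \<in> {p \<in> frames2. frame_span p \<in> U}" using assms by (simp add: frame_span_def)
  ultimately obtain \<delta> where "0 < \<delta>" "ball (v, w) \<delta> \<subseteq> {p \<in> frames2. frame_span p \<in> U}"
    unfolding open_contains_ball by blast
  then show ?thesis using that[of \<delta>] by (auto simp: frame_span_def subset_iff dist_commute)
qed

text \<open>Keeping \<open>v\<close> fixed and moving the second vector tilts a plane of
  \<open>U\<close> about the line through \<open>v\<close>; both the cylinder argument and the
  gluing rely on this freedom.\<close>

lemma open_plane_directions:
  assumes "openin gr2_topology U"
  shows "open {w. (v, w) \<in> frames2 \<and> span {v, w} \<in> U}"
proof -
  have "open ((\<lambda>w. (v, w)) -` {p \<in> frames2. frame_span p \<in> U})"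
    using assms openin_gr2_iff by (intro continuous_open_vimage) (auto intro!: continuous_intros)
  then show ?thesis by (simp add: vimage_def frame_span_def)
qed

lemma open_line_ball:
  fixes x u :: "'a::real_normed_vector"
  assumes "open S" "x \<in> S"
  obtains \<delta> where "0 < \<delta>" "\<And>t. \<bar>t\<bar> < \<delta> \<Longrightarrow> x + t *\<^sub>R u \<in> S"
proof -
  have "open ((\<lambda>t. x + t *\<^sub>R u) -` S)"
    by (intro continuous_open_vimage assms) (auto intro!: continuous_intros)
  moreover have "0 \<in> (\<lambda>t. x + t *\<^sub>R u) -` S" using assms by simp
  ultimately obtain r where "0 < r" "ball 0 r \<subseteq> (\<lambda>t. x + t *\<^sub>R u) -` S"
    using open_contains_ball by metis
  then show ?thesis using that[of r] by (auto simp: subset_iff dist_real_def)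
qed

lemma dd_zero_on_plane:
  assumes H: "subspace H" and x: "x \<in> H" "x \<noteq> 0" and u: "u \<in> H"
    and f: "f differentiable (at x)" "\<And>y. y \<in> H \<Longrightarrow> y \<noteq> 0 \<Longrightarrow> f y = 0"
  shows "dd f u x = 0"
proof -
  obtain \<delta> where \<delta>: "0 < \<delta>" "\<And>t. \<bar>t\<bar> < \<delta> \<Longrightarrow> x + t *\<^sub>R u \<noteq> 0"
    using open_line_ball[of "UNIV - {0}" x u] x(2) by auto
  show ?thesis
    by (rule dd_zero_along[OF f(1) \<delta>(1)]) (use \<delta> f H x u in \<open>auto simp: subspace_add subspace_mul\<close>)
qed

section \<open>Minkowski spaces and their Hessians\<close>

locale minkowski_space =
  fixes \<Phi> :: "'a::euclidean_space \<Rightarrow> real"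
  assumes banach_minkowski: "banach_minkowski_norm \<Phi>"
begin

abbreviation "F \<equiv> (\<lambda>x. (\<Phi> x)\<^sup>2)"
abbreviation "hess x u w \<equiv> dd (dd F u) w x"
abbreviation "S \<equiv> UNIV - {0 :: 'a}"

lemma open_S: "open S" by auto

lemma norm_pos: "v \<noteq> 0 \<Longrightarrow> 0 < \<Phi> v"
  and norm_nonneg: "0 \<le> \<Phi> v"
  and norm_triangle: "\<Phi> (v + w) \<le> \<Phi> v + \<Phi> w"
  using banach_minkowski by (auto simp: banach_minkowski_norm_def nonsymmetric_norm_def)

lemma norm_scale_pos: "0 < c \<Longrightarrow> \<Phi> (c *\<^sub>R v) = c * \<Phi> v"
  using banach_minkowski by (auto simp: banach_minkowski_norm_def nonsymmetric_norm_def)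

lemma norm_zero: "\<Phi> 0 = 0"
  using norm_scale_pos[of 2 0] by simp

lemma norm_scale: "0 \<le> c \<Longrightarrow> \<Phi> (c *\<^sub>R v) = c * \<Phi> v"
  using norm_scale_pos[of c v] norm_zero by (cases "c = 0") auto

lemma F_scale: "0 \<le> c \<Longrightarrow> F (c *\<^sub>R v) = c\<^sup>2 * F v"
  by (simp add: norm_scale power_mult_distrib)

lemma smooth_norm: "smooth_on S \<Phi>"
  using banach_minkowski by (simp add: banach_minkowski_norm_def)

lemma norm_differentiable: "v \<noteq> 0 \<Longrightarrow> \<Phi> differentiable (at v)"
  using smooth_on_differentiable[OF smooth_norm] by simp

lemma smooth_F: "smooth_on S F"
  by (rule smooth_on_power2[OF open_S smooth_norm])

lemma F_differentiable: "v \<noteq> 0 \<Longrightarrow> F differentiable (at v)"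
  "v \<noteq> 0 \<Longrightarrow> dd F a differentiable (at v)"
  "v \<noteq> 0 \<Longrightarrow> dd (dd F a) b differentiable (at v)"
  using smooth_F by (auto intro!: smooth_on_differentiable smooth_on_dd)

lemma dd_F: "v \<noteq> 0 \<Longrightarrow> dd F u v = 2 * \<Phi> v * dd \<Phi> u v"
  using has_derivative_dd[OF has_derivative_power[where n = 2,
      OF dd_has_derivative[OF norm_differentiable]]]
  by simp

lemma hess_pos: "v \<noteq> 0 \<Longrightarrow> u \<noteq> 0 \<Longrightarrow> 0 < hess v u u"
  using banach_minkowski by (simp add: banach_minkowski_norm_def second_differential_dd)

lemma hess_commute: "v \<noteq> 0 \<Longrightarrow> hess v u w = hess v w u"
  using dd_dd_commute[OF open_S smooth_F] by auto

lemma hess_linear: "v \<noteq> 0 \<Longrightarrow> linear (\<lambda>u. hess v u w)" "v \<noteq> 0 \<Longrightarrow> linear (\<lambda>w. hess v u w)"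
  using linear_dd_dd[OF open_S smooth_F] by auto

lemma hess_simps:
  assumes "v \<noteq> 0"
  shows "hess v (a + b) w = hess v a w + hess v b w" "hess v w (a + b) = hess v w a + hess v w b"
    "hess v (a - b) w = hess v a w - hess v b w" "hess v w (a - b) = hess v w a - hess v w b"
    "hess v (c *\<^sub>R a) w = c * hess v a w" "hess v w (c *\<^sub>R a) = c * hess v w a"
  by (simp_all add: linear_add[OF hess_linear(1)[OF assms]] linear_add[OF hess_linear(2)[OF assms]]
      linear_diff[OF hess_linear(1)[OF assms]] linear_diff[OF hess_linear(2)[OF assms]]
      linear_cmul[OF hess_linear(1)[OF assms]] linear_cmul[OF hess_linear(2)[OF assms]])

lemma inner_product_hess:
  assumes "v \<noteq> 0"
  shows "inner_product_on H (\<lambda>x y. hess v x y / 2)"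
  unfolding inner_product_on_def
  using hess_commute[OF assms] hess_pos[OF assms] hess_simps[OF assms]
  by (auto simp: add_divide_distrib)

text \<open>Definiteness of the form is already part of the strict convexity, so being Euclidean
  reduces to an identity between \<open>F\<close> and its second differential at one point.\<close>

lemma euclidean_of_hess:
  assumes "v \<noteq> 0" "\<And>z. z \<in> H \<Longrightarrow> F z = hess v z z / 2"
  shows "euclidean_norm_on H \<Phi>"
  unfolding euclidean_norm_on_def
proof (intro exI conjI ballI)
  show "inner_product_on H (\<lambda>x y. hess v x y / 2)" by (rule inner_product_hess[OF assms(1)])
  fix z assume "z \<in> H"
  then have "hess v z z / 2 = (\<Phi> z)\<^sup>2" using assms(2) by simp
  then show "\<Phi> z = sqrt (hess v z z / 2)" using norm_nonneg[of z] by simp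
qed

lemma hess_scaled:
  assumes "0 < c" "x \<noteq> 0"
  shows "hess (c *\<^sub>R x) u w = hess x u w"
proof -
  have "dd F u (c *\<^sub>R y) = c * dd F u y" if "y \<in> S" for y
  proof -
    have "c * dd F u (c *\<^sub>R y) = c\<^sup>2 * dd F u y"
      using assms that F_scale[of c] by (intro dd_scaled[OF open_S] F_differentiable) auto
    then show ?thesis using assms by (simp add: power2_eq_square)
  qed
  then have "c * dd (dd F u) w (c *\<^sub>R x) = c * dd (dd F u) w x"
    using assms by (intro dd_scaled[OF open_S] F_differentiable) auto
  then show ?thesis using assms by simp
qed

text \<open>The second differential is homogeneous of degree 0, hence constant along the ray through
  \<open>x\<close>; the bound 1 keeps the factor \<open>1 + t\<close> positive.\<close>

lemma third_radial:
  assumes "x \<noteq> 0"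
  shows "dd (dd (dd F a) b) x x = 0"
proof (rule dd_zero_along[where \<delta> = 1])
  show "hess (x + t *\<^sub>R x) a b = hess x a b" if "\<bar>t\<bar> < 1" for t
    using hess_scaled[of "1 + t" x a b] that assms by (simp add: algebra_simps)
qed (use assms F_differentiable in auto)

text \<open>The relation \<open>dd F N y = 0\<close> holds at all nonzero points of
  \<open>H\<close>, so it may be differentiated within \<open>H\<close>, once and then once
  more.\<close>

lemma hess_zero_of_cylinder:
  assumes H: "subspace H" and N: "\<And>y. y \<in> H \<Longrightarrow> y \<noteq> 0 \<Longrightarrow> dd F N y = 0"
    and x: "x \<in> H" "x \<noteq> 0" and u: "u \<in> H"
  shows "hess x N u = 0" "dd (dd (dd F N) u) u x = 0"
proof -
  have 1: "hess y N u = 0" if "y \<in> H" "y \<noteq> 0" for y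
    by (rule dd_zero_on_plane[OF H that u F_differentiable(2)[OF that(2)] N])
  then show "hess x N u = 0" using x by blast
  show "dd (dd (dd F N) u) u x = 0"
    by (rule dd_zero_on_plane[OF H x u F_differentiable(3)[OF x(2)] 1])
qed

lemma third_simps:
  assumes "v \<noteq> 0"
  shows "dd (dd (dd F (a + a')) b) c v = dd (dd (dd F a) b) c v + dd (dd (dd F a') b) c v"
    and "dd (dd (dd F a) (b + b')) c v = dd (dd (dd F a) b) c v + dd (dd (dd F a) b') c v"
    and "dd (dd (dd F a) b) (c + c') v = dd (dd (dd F a) b) c v + dd (dd (dd F a) b) c' v"
    and "dd (dd (dd F (k *\<^sub>R a)) b) c v = k * dd (dd (dd F a) b) c v"
    and "dd (dd (dd F a) (k *\<^sub>R b)) c v = k * dd (dd (dd F a) b) c v"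
    and "dd (dd (dd F a) b) (k *\<^sub>R c) v = k * dd (dd (dd F a) b) c v"
    and "dd (dd (dd F (a - a')) b) c v = dd (dd (dd F a) b) c v - dd (dd (dd F a') b) c v"
proof -
  have S: "v \<in> S" using assms by simp
  have 1: "linear (\<lambda>a. dd (dd (dd F a) b) c v)" for b c
    by (rule linear_dd_dd_dd[OF open_S smooth_F S])
  have 2: "linear (\<lambda>b. dd (dd (dd F a) b) c v)" "linear (\<lambda>c. dd (dd (dd F a) b) c v)" for a b c
    by (rule linear_dd_dd[OF open_S smooth_on_dd[OF smooth_F] S])+
  show "dd (dd (dd F (a + a')) b) c v = dd (dd (dd F a) b) c v + dd (dd (dd F a') b) c v"
    by (rule linear_add[OF 1])
  show "dd (dd (dd F a) (b + b')) c v = dd (dd (dd F a) b) c v + dd (dd (dd F a) b') c v"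
    by (rule linear_add[OF 2(1)])
  show "dd (dd (dd F a) b) (c + c') v = dd (dd (dd F a) b) c v + dd (dd (dd F a) b) c' v"
    by (rule linear_add[OF 2(2)])
  show "dd (dd (dd F (k *\<^sub>R a)) b) c v = k * dd (dd (dd F a) b) c v"
    using linear_cmul[OF 1] by simp
  show "dd (dd (dd F a) (k *\<^sub>R b)) c v = k * dd (dd (dd F a) b) c v"
    using linear_cmul[OF 2(1)] by simp
  show "dd (dd (dd F a) b) (k *\<^sub>R c) v = k * dd (dd (dd F a) b) c v"
    using linear_cmul[OF 2(2)] by simp
  show "dd (dd (dd F (a - a')) b) c v = dd (dd (dd F a) b) c v - dd (dd (dd F a') b) c v"
    by (rule linear_diff[OF 1])
qed

lemma third_commute:
  assumes "v \<noteq> 0"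
  shows "dd (dd (dd F a) b) c v = dd (dd (dd F b) a) c v"
    and "dd (dd (dd F a) b) c v = dd (dd (dd F a) c) b v"
  using dd_dd_dd_commute[OF open_S smooth_F, of v a b c] assms by auto

section \<open>Planes along which the ball is supported by a cylinder\<close>

text \<open>\<open>cylinder_along H\<close>: along \<open>H\<close> the unit ball is supported by a cylinder, whose
  directions span a complement of \<open>H\<close>.\<close>

definition cylinder_along :: "'a set \<Rightarrow> bool" where
  "cylinder_along H \<longleftrightarrow>
     (\<forall>e. e \<notin> H \<longrightarrow> (\<exists>w\<in>H. \<forall>x\<in>H. x \<noteq> 0 \<longrightarrow> dd F (e + w) x = 0))"

text \<open>A normal \<open>N\<close> of \<open>H\<close> with respect to D^2F_v is itself a
  cylinder direction: for the direction \<open>N + w\<close> supplied by the cylinder, D^2F_v(N + w,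
  w) = 0 and D^2F_v(N, w) = 0 leave D^2F_v(w, w) = 0, so \<open>w = 0\<close>.\<close>

lemma hess_orthogonal_in_cylinder:
  assumes H: "H \<in> gr2" and cyl: "cylinder_along H" and frame: "(v, u) \<in> frames2" "v \<in> H" "u \<in> H"
    and N: "N \<noteq> 0" "hess v N v = 0" "hess v N u = 0"
  shows "dd (dd (dd F N) u) u v = 0"
proof -
  have v: "v \<noteq> 0" using frame frames2_nonzero by blast
  have H': "subspace H" using H gr2_subspace by blast
  have perp: "hess v N z = 0" if "z \<in> H" for z
  proof -
    have "z \<in> span {v, u}" using that frame_span_eq[OF H frame] by simp
    then obtain a b where "z = a *\<^sub>R v + b *\<^sub>R u" unfolding mem_span2 by blast
    then show ?thesis using N by (simp add: hess_simps[OF v])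
  qed
  have "N \<notin> H" using perp[of N] hess_pos[OF v N(1)] by auto
  then obtain w where w: "w \<in> H" "\<And>x. x \<in> H \<Longrightarrow> x \<noteq> 0 \<Longrightarrow> dd F (N + w) x = 0"
    using cyl unfolding cylinder_along_def by blast
  have "hess v (N + w) w = 0" by (rule hess_zero_of_cylinder(1)[OF H' w(2) frame(2) v w(1)])
  then have "hess v w w = 0" using perp[OF w(1)] by (simp add: hess_simps[OF v])
  then have "w = 0" using hess_pos[OF v, of w] by auto
  then show ?thesis using hess_zero_of_cylinder(2)[OF H' w(2) frame(2) v frame(3)] by simp
qed

text \<open>The dimension bound enters here, providing a vector off \<open>H\<close>; the cylinder
  direction obtained from it is normal to \<open>H\<close> at every nonzero point of
  \<open>H\<close>.\<close>

lemma hess_orthogonal_complement: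
  assumes dim: "3 \<le> DIM('a)" and H: "H \<in> gr2" and cyl: "cylinder_along H" and v: "v \<in> H" "v \<noteq> 0"
  obtains N where "N \<noteq> 0" "\<And>u. u \<in> H \<Longrightarrow> hess v N u = 0"
proof -
  have "H \<noteq> UNIV" using H dim by (auto simp: gr2_def)
  then obtain e where e: "e \<notin> H" by blast
  then obtain w where w: "w \<in> H" "\<And>x. x \<in> H \<Longrightarrow> x \<noteq> 0 \<Longrightarrow> dd F (e + w) x = 0"
    using cyl unfolding cylinder_along_def by blast
  have H': "subspace H" using H gr2_subspace by blast
  have "e + w \<noteq> 0" using e w(1) subspace_neg[OF H' w(1)] by (metis add_eq_0_iff2)
  then show ?thesis
    using that[of "e + w"] hess_zero_of_cylinder(1)[OF H' w(2) v] by blast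
qed

text \<open>In the plane spanned by \<open>u\<close> and \<open>N\<close> the condition says that the cubic form \<open>D\<^sup>3F\<close> is
  constant on an arc of the unit circle of \<open>D\<^sup>2F\<close>; an odd trigonometric polynomial with this
  property vanishes.\<close>

lemma third_derivative_orthogonal_zero:
  assumes dim: "3 \<le> DIM('a)" and U: "openin gr2_topology U" and cyl: "\<And>H. H \<in> U \<Longrightarrow> cylinder_along H"
    and frame: "(v, u) \<in> frames2" "span {v, u} \<in> U" and orth: "hess v u v = 0"
  shows "dd (dd (dd F u) u) u v = 0"
proof -
  have nz: "v \<noteq> 0" "u \<noteq> 0" using frame frames2_nonzero by blast+
  note lin = hess_simps[OF nz(1)] third_simps[OF nz(1)]
  have gr: "span {v, u} \<in> gr2" by (rule frame_span_in_gr2[OF frame(1)])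
  obtain N0 where N0: "N0 \<noteq> 0" "\<And>z. z \<in> span {v, u} \<Longrightarrow> hess v N0 z = 0"
    using hess_orthogonal_complement[OF dim gr cyl[OF frame(2)] span_base nz(1)] by auto
  \<comment> \<open>\<open>N\<close> is scaled to have the same length as \<open>u\<close> for
    D^2F_v, so that \<open>u + s *\<^sub>R N\<close> and \<open>N - s *\<^sub>R u\<close> are
    orthogonal for every \<open>s\<close>.\<close>
  define N where "N = sqrt (hess v u u / hess v N0 N0) *\<^sub>R N0"
  have pos: "0 < hess v u u" "0 < hess v N0 N0" using hess_pos nz N0 by auto
  have N: "hess v N v = 0" "hess v N u = 0"
    using N0(2)[of u] N0(2)[of v] by (auto simp: N_def lin span_base)
  have NN: "hess v N N = hess v u u"
    using pos by (simp add: N_def lin mult.assoc[symmetric])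
  have N': "hess v v N = 0" "hess v u N = 0" "hess v v u = 0"
    using N orth by (simp_all add: hess_commute[OF nz(1), of v] hess_commute[OF nz(1), of u N])
  have "open {w. (v, w) \<in> frames2 \<and> span {v, w} \<in> U}" by (rule open_plane_directions[OF U])
  then obtain \<delta> where \<delta>: "0 < \<delta>"
    "\<And>s. \<bar>s\<bar> < \<delta> \<Longrightarrow> (v, u + s *\<^sub>R N) \<in> frames2 \<and> span {v, u + s *\<^sub>R N} \<in> U"
    using open_line_ball[of "{w. (v, w) \<in> frames2 \<and> span {v, w} \<in> U}" u N] frame by auto
  define C where "C a b c = dd (dd (dd F a) b) c v" for a b c
  have C: "C N u u = C u u N" "C u N u = C u u N" "C N u N = C u N N" "C N N u = C u N N"
    unfolding C_def using third_commute[OF nz(1)] by metis+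
  \<comment> \<open>For small \<open>s\<close> the plane spanned by \<open>v\<close> and
    \<open>u + s *\<^sub>R N\<close> is in \<open>U\<close> and has \<open>N - s *\<^sub>R u\<close>
    as a normal. The polynomial is D^3F_v(N - s u, u + s N, u + s N), expanded by symmetry and
    multilinearity.\<close>
  have poly: "C u u N + s * (2 * C u N N - C u u u) + s\<^sup>2 * (C N N N - 2 * C u u N) - s^3 * C u N N = 0"
    if s: "\<bar>s\<bar> < \<delta>" for s
  proof -
    have "hess v (N - s *\<^sub>R u) (N - s *\<^sub>R u) = (1 + s\<^sup>2) * hess v u u"
      unfolding lin using N NN N' by (simp add: algebra_simps power2_eq_square[of s])
    moreover have "\<dots> \<noteq> 0" using pos by (auto simp: add_nonneg_eq_0_iff)
    ultimately have "N - s *\<^sub>R u \<noteq> 0" using lin by (metis mult_zero_left scale_zero_left)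
    moreover have "hess v (N - s *\<^sub>R u) v = 0" "hess v (N - s *\<^sub>R u) (u + s *\<^sub>R N) = 0"
      using N NN N' orth by (simp_all add: lin)
    ultimately have "dd (dd (dd F (N - s *\<^sub>R u)) (u + s *\<^sub>R N)) (u + s *\<^sub>R N) v = 0"
      using \<delta>(2)[OF s]
      by (intro hess_orthogonal_in_cylinder[of "span {v, u + s *\<^sub>R N}"] cyl frame_span_in_gr2)
         (auto intro: span_base)
    then have "C (N - s *\<^sub>R u) (u + s *\<^sub>R N) (u + s *\<^sub>R N) = 0" by (simp add: C_def)
    moreover have "C (N - s *\<^sub>R u) (u + s *\<^sub>R N) (u + s *\<^sub>R N) =
        C u u N + s * (2 * C u N N - C u u u) + s\<^sup>2 * (C N N N - 2 * C u u N) - s^3 * C u N N"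
      unfolding C_def lin unfolding C_def[symmetric] C by (simp add: algebra_simps power2_eq_square power3_eq_cube)
    ultimately show ?thesis by simp
  qed
  define h where "h = \<delta> / 2"
  have h: "0 < h" "h < \<delta>" using \<delta> by (auto simp: h_def)
  \<comment> \<open>Subtracting the relations for \<open>k\<close> and \<open>-k\<close> leaves the
    odd part. The left side does not depend on \<open>k\<close>, so two different values of
    \<open>k\<close> force \<open>C u N N = 0\<close>.\<close>
  have odd: "2 * C u N N - C u u u = k\<^sup>2 * C u N N" if k: "0 < k" "k < \<delta>" for k
  proof -
    have "2 * k * (2 * C u N N - C u u u - k\<^sup>2 * C u N N) = 0"
      using poly[of k] poly[of "- k"] k by (simp add: algebra_simps power2_eq_square power3_eq_cube)
    then show ?thesis using k by simp
  qed
  have "h\<^sup>2 * C u N N = (h / 2)\<^sup>2 * C u N N" using odd[of h] odd[of "h/2"] h by simp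
  then have "C u N N = 0" using h by (simp add: power_divide)
  then have "C u u u = 0" using odd[OF h] by simp
  then show ?thesis by (simp add: C_def)
qed

text \<open>The part of \<open>u\<close> along \<open>v\<close> contributes nothing, since D^3F_v
  vanishes as soon as one argument is \<open>v\<close>. The remainder \<open>w\<close> is orthogonal
  to \<open>v\<close> for D^2F_v, which is the case already settled.\<close>

lemma third_derivative_zero:
  assumes dim: "3 \<le> DIM('a)" and U: "openin gr2_topology U" "H \<in> U" and cyl: "\<And>H. H \<in> U \<Longrightarrow> cylinder_along H"
    and v: "v \<in> H" "v \<noteq> 0" and u: "u \<in> H"
  shows "dd (dd (dd F u) u) u v = 0"
proof -
  have H: "H \<in> gr2" using U by (auto simp: openin_gr2_topology)
  define k where "k = hess v u v / hess v v v"
  define w where "w = u - k *\<^sub>R v"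
  have w: "w \<in> H" unfolding w_def using u v gr2_subspace[OF H] by (intro subspace_diff subspace_mul)
  have orth: "hess v w v = 0" using hess_pos[OF v(2) v(2)] by (simp add: w_def hess_simps[OF v(2)] k_def)
  have www: "dd (dd (dd F w) w) w v = 0"
  proof (cases "w = 0")
    case True
    then show ?thesis using third_simps(4)[OF v(2), of 0 0] by simp
  next
    case False
    have "(v, w) \<in> frames2" unfolding mem_frames2
    proof (intro conjI allI)
      show "v \<noteq> 0" by (rule v(2))
      fix c show "w \<noteq> c *\<^sub>R v"
      proof
        assume c: "w = c *\<^sub>R v"
        then show False using orth hess_pos[OF v(2) v(2)] False by (simp add: hess_simps[OF v(2)])
      qed
    qed
    then show ?thesis
      using third_derivative_orthogonal_zero[OF dim U(1) cyl _ _ orth] frame_span_eq[OF H _ v(1) w] U(2) by auto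
  qed
  have rad: "dd (dd (dd F a) b) v v = 0" for a b by (rule third_radial[OF v(2)])
  then have rad': "dd (dd (dd F a) v) b v = 0" "dd (dd (dd F v) a) b v = 0" for a b
    using third_commute[OF v(2)] by metis+
  have "u = w + k *\<^sub>R v" by (simp add: w_def)
  then show ?thesis using www by (simp add: third_simps[OF v(2)] rad rad')
qed

text \<open>The line avoids the origin, so \<open>F\<close> is a polynomial of degree at most 2 on
  all of it. Its leading coefficient is the limit of F(v + t u) / t^2 as t tends to either infinity,
  which by homogeneity is both \<open>F u\<close> and \<open>F (- u)\<close>. The computation uses s
  = 1 / |t|, so that both ends become limits at s = 0.\<close>

lemma F_quadratic_on_lines:
  assumes H: "H \<in> gr2" and third: "\<And>x u. x \<in> H \<Longrightarrow> x \<noteq> 0 \<Longrightarrow> u \<in> H \<Longrightarrow> dd (dd (dd F u) u) u x = 0"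
    and frame: "(v, u) \<in> frames2" "v \<in> H" "u \<in> H"
  obtains b where "\<And>t. F (v + t *\<^sub>R u) = F v + b * t + F u * t\<^sup>2" "F (- u) = F u"
proof -
  have nz: "v + t *\<^sub>R u \<noteq> 0" for t using frames2_coords[OF frame(1), of 1 t] by auto
  have inH: "v + t *\<^sub>R u \<in> H" for t
    using frame gr2_subspace[OF H] by (intro subspace_add subspace_mul)
  define b where "b = dd F u v"
  define c where "c = hess v u u / 2"
  have third0: "((\<lambda>t. dd (dd F u) u (v + t *\<^sub>R u)) has_real_derivative 0) (at t)" for t
    using dd_line[OF F_differentiable(3)[OF nz], of u u t] third[OF inH nz frame(3), of t] by simp
  have quad: "F (v + t *\<^sub>R u) = F v + b * t + c * t\<^sup>2" for t
    using eq_on_line_if_third_derivative_zero[of "\<lambda>t. F (v + t *\<^sub>R u)" "\<lambda>t. dd F u (v + t *\<^sub>R u)"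
       "\<lambda>t. dd (dd F u) u (v + t *\<^sub>R u)" t]
      dd_line[OF F_differentiable(1)[OF nz]] dd_line[OF F_differentiable(2)[OF nz]]
      third0
    by (simp add: b_def c_def)
  have F_end: "F (\<sigma> *\<^sub>R u) = c" if \<sigma>: "\<sigma> = 1 \<or> \<sigma> = -1" for \<sigma> :: real
  proof -
    have eq: "F (s *\<^sub>R v + \<sigma> *\<^sub>R u) = s\<^sup>2 * F v + \<sigma> * b * s + c" if s: "0 < s" for s
    proof -
      have "s *\<^sub>R v + \<sigma> *\<^sub>R u = s *\<^sub>R (v + (\<sigma> / s) *\<^sub>R u)" using s by (simp add: algebra_simps)
      then have "F (s *\<^sub>R v + \<sigma> *\<^sub>R u) = s\<^sup>2 * F (v + (\<sigma> / s) *\<^sub>R u)"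
        using s F_scale[of s "v + (\<sigma> / s) *\<^sub>R u"] by simp
      also have "\<dots> = s\<^sup>2 * F v + \<sigma> * b * s + \<sigma>\<^sup>2 * c"
        unfolding quad using s by (simp add: field_simps power2_eq_square)
      finally show ?thesis using \<sigma> by auto
    qed
    define s where "s n = inverse (real (Suc n))" for n
    have s: "s \<longlonglongrightarrow> 0" unfolding s_def by (rule LIMSEQ_inverse_real_of_nat)
    have nzs: "\<sigma> *\<^sub>R u \<noteq> 0" using \<sigma> frames2_nonzero[OF frame(1)] by auto
    have cont: "isCont F (0 *\<^sub>R v + \<sigma> *\<^sub>R u)"
      using differentiable_imp_continuous_within[OF F_differentiable(1)[OF nzs]] by simp
    have "(\<lambda>n. s n *\<^sub>R v + \<sigma> *\<^sub>R u) \<longlonglongrightarrow> 0 *\<^sub>R v + \<sigma> *\<^sub>R u"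
      by (intro tendsto_intros s)
    from isCont_tendsto_compose[OF cont this] have "(\<lambda>n. F (s n *\<^sub>R v + \<sigma> *\<^sub>R u)) \<longlonglongrightarrow> F (\<sigma> *\<^sub>R u)" by simp
    moreover have "(\<lambda>n. (s n)\<^sup>2 * F v + \<sigma> * b * s n + c) \<longlonglongrightarrow> 0\<^sup>2 * F v + \<sigma> * b * 0 + c"
      by (intro tendsto_intros s)
    moreover have "F (s n *\<^sub>R v + \<sigma> *\<^sub>R u) = (s n)\<^sup>2 * F v + \<sigma> * b * s n + c" for n
      by (rule eq) (simp add: s_def)
    ultimately show ?thesis using LIMSEQ_unique by fastforce
  qed
  show ?thesis using that[of b] quad F_end[of 1] F_end[of "-1"] by simp
qed

lemma euclidean_if_third_derivative_zero:
  assumes H: "H \<in> gr2" and third: "\<And>x u. x \<in> H \<Longrightarrow> x \<noteq> 0 \<Longrightarrow> u \<in> H \<Longrightarrow> dd (dd (dd F u) u) u x = 0"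
  shows "euclidean_norm_on H \<Phi>"
proof -
  obtain v w where vw: "(v, w) \<in> frames2" "H = span {v, w}" using gr2_obtain_frame[OF H] by blast
  have v: "v \<in> H" "v \<noteq> 0" "w \<in> H" using vw frames2_nonzero[OF vw(1)] by (auto intro: span_base)
  have vS: "v \<in> S" using v by simp
  \<comment> \<open>Evenness at \<open>v\<close> comes from the two ends of a line in direction
    \<open>v\<close>, here through \<open>w\<close>. It is used below for negative multiples of
    \<open>v\<close>, whose lines through \<open>v\<close> pass through the origin.\<close>
  have even: "F (- v) = F v" using F_quadratic_on_lines[OF H third frames2_swap[OF vw(1)]] v by blast
  have radial: "F v = hess v v v / 2"
  proof -
    have "F (v + t *\<^sub>R v) = F v + (2 * F v) * t + F v * t\<^sup>2" if "\<bar>t\<bar> < 1" for t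
      using F_scale[of "1 + t" v] that by (simp add: algebra_simps power2_eq_square)
    from dd_dd_quadratic[OF open_S smooth_F vS zero_less_one this] show ?thesis by simp
  qed
  show ?thesis
  proof (rule euclidean_of_hess[OF v(2)])
    fix z assume z: "z \<in> H"
    show "F z = hess v z z / 2"
    proof (cases "(v, z) \<in> frames2")
      case True
      obtain b where "\<And>t. F (v + t *\<^sub>R z) = F v + b * t + F z * t\<^sup>2"
        using F_quadratic_on_lines[OF H third True v(1) z] by blast
      from dd_dd_quadratic[OF open_S smooth_F vS zero_less_one this] show ?thesis by simp
    next
      case False
      then obtain c where c: "z = c *\<^sub>R v" using v mem_frames2 by blast
      have "F (c *\<^sub>R v) = c\<^sup>2 * F v"
      proof (cases "0 \<le> c")
        case True
        then show ?thesis by (rule F_scale)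
      next
        case False
        then show ?thesis using F_scale[of "- c" "- v"] even by simp
      qed
      then show ?thesis unfolding c hess_simps[OF v(2)]
        using radial by (simp add: power2_eq_square[of c])
    qed
  qed
qed

lemma euclidean_if_cylinders:
  assumes "3 \<le> DIM('a)" "openin gr2_topology U" "\<And>H. H \<in> U \<Longrightarrow> cylinder_along H" "H \<in> U"
  shows "euclidean_norm_on H \<Phi>"
  using assms by (intro euclidean_if_third_derivative_zero third_derivative_zero) (auto simp: openin_gr2_topology)

section \<open>Gluing Euclidean planes\<close>

text \<open>On \<open>H\<close> the function \<open>F\<close> is a quadratic form, and its second
  differential at any nonzero point of \<open>H\<close> recovers that form. This makes inner
  products on different planes comparable through the ambient second differentials.\<close>

lemma hess_of_euclidean:
  assumes H: "subspace H" and eucl: "euclidean_norm_on H \<Phi>" and v: "v \<in> H" "v \<noteq> 0" and w: "w \<in> H"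
  shows "F w = hess v w w / 2"
proof -
  obtain b where b: "inner_product_on H b" "\<And>z. z \<in> H \<Longrightarrow> \<Phi> z = sqrt (b z z)"
    using eucl by (auto simp: euclidean_norm_on_def)
  have sym: "b x y = b y x" and add: "b (x + y) z = b x z + b y z" and scale: "b (c *\<^sub>R x) y = c * b x y"
    if "x \<in> H" "y \<in> H" "z \<in> H" for x y z c
    using b(1) that unfolding inner_product_on_def by blast+
  have nonneg: "0 \<le> b z z" if "z \<in> H" for z
  proof (cases "z = 0")
    case True
    then show ?thesis using scale[OF that that that, of 0] by simp
  qed (use b(1) that in \<open>auto simp: inner_product_on_def less_imp_le\<close>)
  have Fb: "F z = b z z" if "z \<in> H" for z
    using b(2)[OF that] nonneg[OF that] by simp
  have line: "F (v + t *\<^sub>R w) = F v + 2 * b v w * t + F w * t\<^sup>2" for t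
  proof -
    have tw: "t *\<^sub>R w \<in> H" "v + t *\<^sub>R w \<in> H" using H v w by (auto simp: subspace_add subspace_mul)
    have "b (v + t *\<^sub>R w) (v + t *\<^sub>R w) = b v (v + t *\<^sub>R w) + t * b w (v + t *\<^sub>R w)"
      using add[OF v(1) tw(1) tw(2)] scale[OF w tw(2) w] by simp
    also have "b v (v + t *\<^sub>R w) = b v v + t * b v w"
      using sym[OF v(1) tw(2) w] add[OF v(1) tw(1) v(1)] scale[OF w v(1) w] sym[OF w v(1) w] by simp
    also have "b w (v + t *\<^sub>R w) = b v w + t * b w w"
      using sym[OF w tw(2) w] add[OF v(1) tw(1) w] scale[OF w w w] by simp
    finally show ?thesis using Fb[OF tw(2)] Fb[OF v(1)] Fb[OF w] by (simp add: algebra_simps power2_eq_square)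
  qed
  have "hess v w w = 2 * F w"
    by (rule dd_dd_quadratic[OF open_S smooth_F _ zero_less_one line]) (use v in auto)
  then show ?thesis by simp
qed

text \<open>The direction \<open>u\<close> is arbitrary and may leave the plane: for small
  \<open>t\<close> the vectors \<open>v\<close> and \<open>w + t *\<^sub>R u\<close> still span a
  plane of \<open>U\<close>, which is Euclidean. Hence near \<open>w\<close> the function
  \<open>F\<close> is the quadratic form D^2F_v / 2, whose second differential at \<open>w\<close>
  is again D^2F_v.\<close>

lemma hess_eq_of_frame:
  assumes U: "openin gr2_topology U" and eucl: "\<And>H. H \<in> U \<Longrightarrow> euclidean_norm_on H \<Phi>"
    and frame: "(v, w) \<in> frames2" "span {v, w} \<in> U"
  shows "hess w u u = hess v u u"
proof -
  have nz: "v \<noteq> 0" "w \<noteq> 0" using frames2_nonzero[OF frame(1)] by auto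
  have "open {w. (v, w) \<in> frames2 \<and> span {v, w} \<in> U}" by (rule open_plane_directions[OF U])
  then obtain \<delta> where \<delta>: "0 < \<delta>"
    "\<And>t. \<bar>t\<bar> < \<delta> \<Longrightarrow> w + t *\<^sub>R u \<in> {w. (v, w) \<in> frames2 \<and> span {v, w} \<in> U}"
    using open_line_ball[of "{w. (v, w) \<in> frames2 \<and> span {v, w} \<in> U}" w u] frame by blast
  have line: "F (w + t *\<^sub>R u) = hess v w w / 2 + hess v w u * t + (hess v u u / 2) * t\<^sup>2"
    if "\<bar>t\<bar> < \<delta>" for t
  proof -
    have "F (w + t *\<^sub>R u) = hess v (w + t *\<^sub>R u) (w + t *\<^sub>R u) / 2"
      using \<delta>(2)[OF that] nz(1)
      by (intro hess_of_euclidean[of "span {v, w + t *\<^sub>R u}"] eucl) (auto intro: span_base)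
    also have "\<dots> = hess v w w / 2 + hess v w u * t + (hess v u u / 2) * t\<^sup>2"
      unfolding hess_simps[OF nz(1)] hess_commute[OF nz(1), of u w]
      by (simp add: field_simps power2_eq_square[of t])
    finally show ?thesis .
  qed
  have "hess w u u = 2 * (hess v u u / 2)"
    by (rule dd_dd_quadratic[OF open_S smooth_F _ \<delta>(1) line]) (use nz in auto)
  then show ?thesis by simp
qed

lemma hess_eq_on_plane:
  assumes U: "openin gr2_topology U" and eucl: "\<And>H. H \<in> U \<Longrightarrow> euclidean_norm_on H \<Phi>"
    and H: "H \<in> U" and v: "v \<in> H" "v \<noteq> 0" and w: "w \<in> H" "w \<noteq> 0"
  shows "hess w u u = hess v u u"
proof -
  have gr: "H \<in> gr2" using U H by (auto simp: openin_gr2_topology)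
  have *: "hess y u u = hess x u u" if "(x, y) \<in> frames2" "x \<in> H" "y \<in> H" for x y
    using hess_eq_of_frame[OF U eucl that(1)] frame_span_eq[OF gr that] H by simp
  show ?thesis
  proof (cases "(v, w) \<in> frames2")
    case True
    then show ?thesis using * v w by blast
  next
    case False
    then obtain c where c: "w = c *\<^sub>R v" using v mem_frames2 by blast
    \<comment> \<open>Proportional vectors are compared through a third vector of the plane that is
      independent of both.\<close>
    obtain z where z: "z \<in> H" "(v, z) \<in> frames2" using gr2_extend_frame[OF gr v] by blast
    have "(w, z) \<in> frames2" using frames2_comb[OF z(2), of c 1 0 0] c w by auto
    then show ?thesis using *[OF z(2) v(1) z(1)] *[of w z] w z by simp
  qed
qed

text \<open>Moving \<open>v\<close> to \<open>v'\<close> while keeping \<open>w\<close> stays in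
  \<open>U\<close>, and both second differentials then equal the one at \<open>w\<close>. This is
  local constancy as the plane varies.\<close>

lemma hess_eq_near_frame:
  assumes U: "openin gr2_topology U" and eucl: "\<And>H. H \<in> U \<Longrightarrow> euclidean_norm_on H \<Phi>"
    and frame: "(v, w) \<in> frames2" "span {v, w} \<in> U"
  obtains \<delta> where "0 < \<delta>"
    "\<And>v' w' u. dist (v', w') (v, w) < \<delta> \<Longrightarrow>
      (v', w') \<in> frames2 \<and> span {v', w'} \<in> U \<and> hess v' u u = hess v u u"
proof -
  obtain \<delta> where \<delta>: "0 < \<delta>"
    "\<And>v' w'. dist (v', w') (v, w) < \<delta> \<Longrightarrow> (v', w') \<in> frames2 \<and> span {v', w'} \<in> U"
    using openin_gr2_ball[OF U frame] by blast
  show ?thesis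
  proof (rule that[OF \<delta>(1)])
    fix v' w' u assume d: "dist (v', w') (v, w) < \<delta>"
    have "dist (v', w) (v, w) \<le> dist (v', w') (v, w)" by (simp add: dist_Pair_Pair)
    then have *: "(v', w) \<in> frames2" "span {v', w} \<in> U" using \<delta>(2)[of v' w] d by auto
    have "hess w u u = hess v' u u" by (rule hess_eq_of_frame[OF U eucl *])
    moreover have "hess w u u = hess v u u" by (rule hess_eq_of_frame[OF U eucl frame])
    ultimately show "(v', w') \<in> frames2 \<and> span {v', w'} \<in> U \<and> hess v' u u = hess v u u"
      using \<delta>(2)[OF d] by simp
  qed
qed

lemma hess_constant:
  assumes U: "openin gr2_topology U" "connectedin gr2_topology U"
    and eucl: "\<And>H. H \<in> U \<Longrightarrow> euclidean_norm_on H \<Phi>"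
    and H: "H \<in> U" "v \<in> H" "v \<noteq> 0" and H': "H' \<in> U" "v' \<in> H'" "v' \<noteq> 0"
  shows "hess v' u u = hess v u u"
proof -
  define same where "same x \<longleftrightarrow> (\<forall>u. hess x u u = hess v u u)" for x
  \<comment> \<open>Indexing by the truth value \<open>P\<close> lets one argument show that both
    \<open>A True\<close> and \<open>A False\<close> are open; they split \<open>U\<close>, so
    connectedness empties the one that does not contain \<open>H\<close>.\<close>
  define A where "A P = {H \<in> U. \<exists>x \<in> H. x \<noteq> 0 \<and> same x = P}" for P
  have A: "span {x, y} \<in> A P \<longleftrightarrow> span {x, y} \<in> U \<and> same x = P" if "(x, y) \<in> frames2" for x y P
  proof -
    have "x \<noteq> 0" "x \<in> span {x, y}" using frames2_nonzero[OF that] by (auto intro: span_base)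
    moreover have "same z = same x" if z: "span {x, y} \<in> U" "z \<in> span {x, y}" "z \<noteq> 0" for z
    proof -
      have "hess z u u = hess x u u" for u
        by (rule hess_eq_on_plane[OF U(1) eucl z(1)]) (use z \<open>x \<noteq> 0\<close> in \<open>auto intro: span_base\<close>)
      then show ?thesis by (simp add: same_def)
    qed
    ultimately show ?thesis unfolding A_def by blast
  qed
  have "openin gr2_topology (A P)" for P
    unfolding openin_gr2_iff
  proof
    show "A P \<subseteq> gr2" using U(1) by (auto simp: A_def openin_gr2_topology)
    show "open {p \<in> frames2. frame_span p \<in> A P}"
      unfolding open_dist
    proof (clarsimp simp: frame_span_def)
      fix x y assume xy: "(x, y) \<in> frames2" "span {x, y} \<in> A P"
      then have "span {x, y} \<in> U" "same x = P" using A by blast+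
      then obtain \<delta> where \<delta>: "0 < \<delta>" "\<And>x' y' u. dist (x', y') (x, y) < \<delta> \<Longrightarrow>
          (x', y') \<in> frames2 \<and> span {x', y'} \<in> U \<and> hess x' u u = hess x u u"
        using hess_eq_near_frame[OF U(1) eucl xy(1)] by blast
      have "(x', y') \<in> frames2 \<and> span {x', y'} \<in> A P" if "dist (x', y') (x, y) < \<delta>" for x' y'
      proof -
        note near = \<delta>(2)[OF that]
        have "same x' = same x" unfolding same_def using near by simp
        then show ?thesis using near A[of x' y' P] \<open>same x = P\<close> by blast
      qed
      then show "\<exists>e>0. \<forall>x' y'. dist (x', y') (x, y) < e \<longrightarrow> (x', y') \<in> frames2 \<and> span {x', y'} \<in> A P"
        using \<delta>(1) by blast
    qed
  qed
  moreover have "U \<subseteq> A True \<union> A False"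
  proof
    fix K assume K: "K \<in> U"
    then obtain x y where "(x, y) \<in> frames2" "K = span {x, y}"
      using gr2_obtain_frame U(1) by (metis openin_gr2_topology subsetD)
    then show "K \<in> A True \<union> A False" using A K by auto
  qed
  moreover have "A True \<inter> A False = {}"
  proof -
    have False if K: "K \<in> A True" "K \<in> A False" for K
    proof -
      have "K \<in> gr2" using K U(1) by (auto simp: A_def openin_gr2_topology)
      then obtain x y where "(x, y) \<in> frames2" "K = span {x, y}" by (rule gr2_obtain_frame)
      then show False using A K by auto
    qed
    then show ?thesis by blast
  qed
  moreover have "H \<in> A True" using H unfolding A_def same_def by blast
  ultimately have "A False \<inter> U = {}"
    using U(2) H(1) unfolding connectedin by (metis (no_types, lifting) IntI empty_iff inf_bot_left)
  then have "same v'" using H' unfolding A_def by blast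
  then show ?thesis by (simp add: same_def)
qed

lemma euclidean_extension:
  assumes U: "openin gr2_topology U" "connectedin gr2_topology U"
    and eucl: "\<And>H. H \<in> U \<Longrightarrow> euclidean_norm_on H \<Phi>"
  shows "\<exists>\<Psi>. euclidean_norm_on UNIV \<Psi> \<and> (\<forall>H\<in>U. \<forall>v\<in>H. \<Psi> v = \<Phi> v)"
proof (cases "U = {}")
  case True
  have "inner_product_on UNIV ((\<bullet>) :: 'a \<Rightarrow> 'a \<Rightarrow> real)"
    by (auto simp: inner_product_on_def inner_add_left intro: inner_commute)
  then have "euclidean_norm_on UNIV (norm :: 'a \<Rightarrow> real)"
    unfolding euclidean_norm_on_def using norm_eq_sqrt_inner by blast
  then show ?thesis using True by blast
next
  case False
  have sub: "subspace H" "\<exists>v\<in>H. v \<noteq> 0" if H: "H \<in> U" for H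
  proof -
    have "H \<in> gr2" using U(1) H by (auto simp: openin_gr2_topology)
    then obtain x y where "(x, y) \<in> frames2" "H = span {x, y}" by (rule gr2_obtain_frame)
    then show "subspace H" "\<exists>v\<in>H. v \<noteq> 0" using frames2_nonzero[of x y] by (auto intro!: bexI[of _ x] span_base)
  qed
  obtain H0 v0 where 0: "H0 \<in> U" "v0 \<in> H0" "v0 \<noteq> 0" using False sub(2) by blast
  define \<Psi> where "\<Psi> z = sqrt (hess v0 z z / 2)" for z
  have "euclidean_norm_on UNIV \<Psi>"
    unfolding euclidean_norm_on_def \<Psi>_def using inner_product_hess[OF 0(3)] by blast
  moreover have "\<Psi> z = \<Phi> z" if "H \<in> U" "z \<in> H" for H z
  proof -
    obtain v where v: "v \<in> H" "v \<noteq> 0" using sub(2) \<open>H \<in> U\<close> by blast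
    have "F z = hess v z z / 2"
      using hess_of_euclidean sub(1) eucl v that by blast
    also have "hess v z z = hess v0 z z" by (rule hess_constant[OF U eucl 0 that(1) v])
    finally have "hess v0 z z / 2 = F z" ..
    then show ?thesis unfolding \<Psi>_def using norm_nonneg[of z] by simp
  qed
  ultimately show ?thesis by blast
qed

section \<open>Flows of isometries of a plane\<close>

lemma dd_norm_self:
  assumes "v \<noteq> 0"
  shows "dd \<Phi> v v = \<Phi> v"
proof -
  have d: "((\<lambda>t. \<Phi> (v + t *\<^sub>R v)) has_real_derivative dd \<Phi> v v) (at 0)"
    using dd_line[of \<Phi> v 0 v] norm_differentiable[OF assms] by simp
  have "\<Phi> (v + t *\<^sub>R v) = (1 + t) * \<Phi> v" if "\<bar>t\<bar> < 1" for t
    using norm_scale[of "1 + t" v] that by (simp add: algebra_simps)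
  then have "((\<lambda>t. (1 + t) * \<Phi> v) has_real_derivative dd \<Phi> v v) (at 0)"
    by (intro has_field_derivative_transform_within_open[OF d, of "ball 0 1"]) (auto simp: dist_real_def)
  moreover have "((\<lambda>t. (1 + t) * \<Phi> v) has_real_derivative \<Phi> v) (at 0)"
    by (auto intro!: derivative_eq_intros)
  ultimately show ?thesis by (rule DERIV_unique)
qed

lemma dd_norm_linear: "v \<noteq> 0 \<Longrightarrow> linear (\<lambda>u. dd \<Phi> u v)"
  by (intro linear_dd norm_differentiable)

lemma norm_constant_on_curve:
  assumes "\<And>t. (\<gamma> has_vector_derivative \<gamma>' t) (at t)" "\<And>t. \<gamma> t \<noteq> 0" "\<And>t. dd \<Phi> (\<gamma>' t) (\<gamma> t) = 0"
  shows "\<Phi> (\<gamma> t) = \<Phi> (\<gamma> 0)"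
proof -
  have "((\<lambda>t. \<Phi> (\<gamma> t)) has_real_derivative 0) (at t)" for t
  proof -
    have "(\<gamma> has_derivative (\<lambda>h. h *\<^sub>R \<gamma>' t)) (at t)"
      using assms(1) by (simp add: has_vector_derivative_def)
    from diff_chain_at[OF this dd_has_derivative[OF norm_differentiable[OF assms(2)]]]
    have "((\<lambda>t. \<Phi> (\<gamma> t)) has_derivative (\<lambda>h. dd \<Phi> (h *\<^sub>R \<gamma>' t) (\<gamma> t))) (at t)"
      by (simp add: o_def)
    moreover have "(\<lambda>h. dd \<Phi> (h *\<^sub>R \<gamma>' t) (\<gamma> t)) = (*) 0"
      using linear_cmul[OF dd_norm_linear[OF assms(2)]] assms(3) by auto
    ultimately show ?thesis by (simp add: has_field_derivative_def)
  qed
  then show ?thesis using DERIV_isconst_all[of "\<lambda>t. \<Phi> (\<gamma> t)"] by blast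
qed

text \<open>\<open>killing_on H B\<close>: the flow of \<open>B\<close> on \<open>H\<close> consists of isometries.\<close>

definition killing_on :: "'a set \<Rightarrow> ('a \<Rightarrow> 'a) \<Rightarrow> bool" where
  "killing_on H B \<longleftrightarrow> linear B \<and> B ` H \<subseteq> H \<and> (\<forall>v\<in>H. v \<noteq> 0 \<longrightarrow> dd \<Phi> (B v) v = 0)"

text \<open>On an eigenvector the flow is a dilation, and by Euler's relation
  \<open>dd_norm_self\<close> a dilation preserves \<Phi> infinitesimally only if its rate is
  0.\<close>

lemma killing_eigenvalue:
  assumes "killing_on H B" "v \<in> H" "v \<noteq> 0" "B v = c *\<^sub>R v"
  shows "c = 0"
proof -
  have "0 = dd \<Phi> (c *\<^sub>R v) v" using assms unfolding killing_on_def by metis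
  also have "\<dots> = c * \<Phi> v"
    using linear_cmul[OF dd_norm_linear[OF assms(3)], of c v] dd_norm_self[OF assms(3)] by simp
  finally show ?thesis using norm_pos[OF assms(3)] by simp
qed

text \<open>The flow would be a shear, and \<Phi> would be constant on the whole line v + t w,
  although it is unbounded there.\<close>

lemma killing_not_unipotent:
  assumes H: "H \<in> gr2" and B: "killing_on H B" and frame: "(v, w) \<in> frames2" "v \<in> H" "w \<in> H"
  shows "\<not> (B v = w \<and> B w = 0)"
proof
  assume Bvw: "B v = w \<and> B w = 0"
  have nz: "v + t *\<^sub>R w \<noteq> 0" for t using frames2_coords[OF frame(1), of 1 t] by auto
  have inH: "v + t *\<^sub>R w \<in> H" for t
    using frame gr2_subspace[OF H] by (intro subspace_add subspace_mul)
  have "B (v + t *\<^sub>R w) = w" for t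
    using B Bvw by (simp add: killing_on_def linear_add linear_cmul)
  then have dw: "dd \<Phi> w (v + t *\<^sub>R w) = 0" for t
    using B inH nz unfolding killing_on_def by metis
  have const: "\<Phi> (v + t *\<^sub>R w) = \<Phi> v" for t
  proof -
    have "((\<lambda>t. v + t *\<^sub>R w) has_vector_derivative w) (at t)" for t
      unfolding has_vector_derivative_def by (auto intro!: derivative_eq_intros)
    from norm_constant_on_curve[OF this nz dw] show ?thesis by simp
  qed
  have w: "w \<noteq> 0" using frames2_nonzero[OF frame(1)] by simp
  \<comment> \<open>Large enough to make \<open>t * \<Phi> w\<close> exceed the triangle bound
    \<open>\<Phi> v + \<Phi> (- v)\<close> by 1; the term \<open>\<Phi> (- v)\<close> is kept
    separate because the norm need not be symmetric.\<close>
  define t where "t = (\<Phi> v + \<Phi> (- v) + 1) / \<Phi> w"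
  have t: "0 < t" using norm_pos[OF w] norm_nonneg[of v] norm_nonneg[of "- v"] by (simp add: t_def)
  have "t * \<Phi> w = \<Phi> ((v + t *\<^sub>R w) + - v)" using norm_scale_pos[OF t, of w] by simp
  also have "\<dots> \<le> \<Phi> v + \<Phi> (- v)" using norm_triangle[of "v + t *\<^sub>R w" "- v"] const[of t] by simp
  also have "\<dots> < t * \<Phi> w" using norm_pos[OF w] by (simp add: t_def)
  finally show False by simp
qed

text \<open>The orbit \<gamma> of \<open>v\<close> under the flow is a logarithmic spiral in the
  coordinates of the frame, and \<Phi> is constant on it. The spiral has to close up, so it is an
  ellipse centred at 0 and a level set of \<Phi>.\<close>

lemma killing_rotation_euclidean:
  assumes H: "H \<in> gr2" and B: "killing_on H B" and frame: "(v, w) \<in> frames2" "v \<in> H" "w \<in> H"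
    and Bv: "B v = p *\<^sub>R v + q *\<^sub>R w" and Bw: "B w = - q *\<^sub>R v + p *\<^sub>R w" and q: "0 < q"
  shows "euclidean_norm_on H \<Phi>"
proof -
  have v: "v \<noteq> 0" using frames2_nonzero[OF frame(1)] by simp
  define \<rho> where "\<rho> \<theta> = cos \<theta> *\<^sub>R v + sin \<theta> *\<^sub>R w" for \<theta>
  define \<gamma> where "\<gamma> t = exp (p * t) *\<^sub>R \<rho> (q * t)" for t
  have \<rho>: "\<rho> \<theta> \<noteq> 0" "\<rho> \<theta> \<in> H" for \<theta>
  proof -
    show "\<rho> \<theta> \<noteq> 0"
      using frames2_coords[OF frame(1), of "cos \<theta>" "sin \<theta>"] sin_zero_abs_cos_one[of \<theta>]
      by (auto simp: \<rho>_def)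
    show "\<rho> \<theta> \<in> H" unfolding \<rho>_def using frame gr2_subspace[OF H]
      by (intro subspace_add subspace_mul)
  qed
  have \<gamma>: "\<gamma> t \<noteq> 0" "\<gamma> t \<in> H" for t
    using \<rho> subspace_mul[OF gr2_subspace[OF H]] by (auto simp: \<gamma>_def)
  have linB: "linear B" using B by (simp add: killing_on_def)
  have B\<gamma>: "B (\<gamma> t) = (exp (p * t) * (p * cos (q * t) - q * sin (q * t))) *\<^sub>R v
      + (exp (p * t) * (p * sin (q * t) + q * cos (q * t))) *\<^sub>R w" for t
    by (simp add: \<gamma>_def \<rho>_def linear_add[OF linB] linear_cmul[OF linB] Bv Bw algebra_simps)
  have \<gamma>_eq: "\<gamma> = (\<lambda>t. (exp (p * t) * cos (q * t)) *\<^sub>R v + (exp (p * t) * sin (q * t)) *\<^sub>R w)"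
    by (auto simp: \<gamma>_def \<rho>_def algebra_simps)
  have deriv: "(\<gamma> has_vector_derivative B (\<gamma> t)) (at t)" for t
  proof -
    have "((\<lambda>t. exp (p * t) * cos (q * t)) has_real_derivative
        exp (p * t) * (p * cos (q * t) - q * sin (q * t))) (at t)"
      by (auto intro!: derivative_eq_intros simp: algebra_simps)
    moreover have "((\<lambda>t. exp (p * t) * sin (q * t)) has_real_derivative
        exp (p * t) * (p * sin (q * t) + q * cos (q * t))) (at t)"
      by (auto intro!: derivative_eq_intros simp: algebra_simps)
    ultimately show ?thesis unfolding B\<gamma> unfolding \<gamma>_eq
      using has_vector_derivative_add[OF has_vector_derivative_scaleR[OF _ has_vector_derivative_const]
          has_vector_derivative_scaleR[OF _ has_vector_derivative_const]] by fastforce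
  qed
  have const: "\<Phi> (\<gamma> t) = \<Phi> v" for t
  proof -
    have "\<Phi> (\<gamma> t) = \<Phi> (\<gamma> 0)"
      using B \<gamma> by (intro norm_constant_on_curve[OF deriv]) (auto simp: killing_on_def)
    then show ?thesis by (simp add: \<gamma>_def \<rho>_def)
  qed
  \<comment> \<open>After one full turn the orbit is back on the ray through \<open>v\<close>,
    scaled by an exponential; constancy of \<Phi> makes this factor 1.\<close>
  have "\<gamma> (2 * pi / q) = exp (p * (2 * pi / q)) *\<^sub>R v"
    using q by (simp add: \<gamma>_def \<rho>_def)
  then have "exp (p * (2 * pi / q)) * \<Phi> v = \<Phi> v"
    using const[of "2 * pi / q"] by (simp add: norm_scale)
  then have p: "p = 0" using norm_pos[OF v] q by simp
  have circle: "\<Phi> (\<rho> \<theta>) = \<Phi> v" for \<theta>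
    using const[of "\<theta> / q"] q p by (simp add: \<gamma>_def)
  have F: "F (x *\<^sub>R v + y *\<^sub>R w) = (x\<^sup>2 + y\<^sup>2) * F v" for x y
  proof (cases "x = 0 \<and> y = 0")
    case True
    then show ?thesis by (simp add: norm_zero)
  next
    case False
    define r where "r = sqrt (x\<^sup>2 + y\<^sup>2)"
    have r: "0 < r" "r\<^sup>2 = x\<^sup>2 + y\<^sup>2" using False by (auto simp: r_def sum_power2_gt_zero_iff)
    have "(x / r)\<^sup>2 + (y / r)\<^sup>2 = (x\<^sup>2 + y\<^sup>2) / r\<^sup>2" by (simp add: power_divide add_divide_distrib)
    also have "\<dots> = 1" using r(1) unfolding r(2)[symmetric] by simp
    finally obtain \<theta> where "x / r = cos \<theta>" "y / r = sin \<theta>" using sincos_total_2pi by metis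
    then have "x *\<^sub>R v + y *\<^sub>R w = r *\<^sub>R \<rho> \<theta>"
      using r(1) by (simp add: \<rho>_def field_simps)
    then show ?thesis using F_scale[of r "\<rho> \<theta>"] r circle[of \<theta>] by simp
  qed
  show ?thesis
  proof (rule euclidean_of_hess[OF v])
    fix z assume "z \<in> H"
    then obtain x y where z: "z = x *\<^sub>R v + y *\<^sub>R w"
      using frame_span_eq[OF H frame] mem_span2 by blast
    have "F (v + t *\<^sub>R z) = F v + (2 * x * F v) * t + F z * t\<^sup>2" for t
    proof -
      have "v + t *\<^sub>R z = (1 + t * x) *\<^sub>R v + (t * y) *\<^sub>R w" by (simp add: z algebra_simps)
      then have "F (v + t *\<^sub>R z) = ((1 + t * x)\<^sup>2 + (t * y)\<^sup>2) * F v" using F by simp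
      also have "\<dots> = F v + (2 * x * F v) * t + ((x\<^sup>2 + y\<^sup>2) * F v) * t\<^sup>2"
        by (simp add: algebra_simps power2_eq_square)
      also have "(x\<^sup>2 + y\<^sup>2) * F v = F z" unfolding z by (rule F[symmetric])
      finally show ?thesis .
    qed
    then have "hess v z z = 2 * F z"
      using v by (intro dd_dd_quadratic[OF open_S smooth_F _ zero_less_one]) auto
    then show "F z = hess v z z / 2" by simp
  qed
qed

text \<open>In the basis \<open>v\<close>, \<open>f = B v\<close> the characteristic polynomial is
  X^2 - \<beta> X - \<alpha>. Real roots must be 0, which makes the flow a shear and is impossible;
  a pair of complex roots p + iq, p - iq gives a rotation up to scale.\<close>

lemma killing_euclidean:
  assumes H: "H \<in> gr2" and B: "killing_on H B" and v: "v \<in> H" "B v \<noteq> 0"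
  shows "euclidean_norm_on H \<Phi>"
proof -
  have linB: "linear B" and BH: "\<And>x. x \<in> H \<Longrightarrow> B x \<in> H" using B by (auto simp: killing_on_def)
  have subH: "subspace H" by (rule gr2_subspace[OF H])
  have v0: "v \<noteq> 0" using v(2) linear_0[OF linB] by auto
  define f where "f = B v"
  have f: "f \<in> H" "f \<noteq> 0" using v BH by (auto simp: f_def)
  have frame: "(v, f) \<in> frames2"
    unfolding mem_frames2
  proof (intro conjI allI)
    show "v \<noteq> 0" by (rule v0)
    show "f \<noteq> c *\<^sub>R v" for c
      using killing_eigenvalue[OF B v(1) v0, of c] f by (auto simp: f_def)
  qed
  obtain \<alpha> \<beta> where Bf: "B f = \<alpha> *\<^sub>R v + \<beta> *\<^sub>R f"
    using frame_span_eq[OF H frame v(1) f(1)] BH[OF f(1)] mem_span2 by blast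
  show ?thesis
  proof (cases "0 \<le> \<beta>\<^sup>2 + 4 * \<alpha>")
    case True
    \<comment> \<open>By Cayley-Hamilton, (B - r') v is an eigenvector for the other root r; it is
      nonzero because \<open>v\<close> is not an eigenvector.\<close>
    have root: "r = 0" if r: "r + r' = \<beta>" "r * r' = - \<alpha>" for r r'
    proof (rule killing_eigenvalue[OF B])
      show "f - r' *\<^sub>R v \<in> H" using subH f v by (intro subspace_diff subspace_mul)
      show "f - r' *\<^sub>R v \<noteq> 0" using frame mem_frames2 by (metis eq_iff_diff_eq_0)
      have "\<alpha> = - (r * r')" "\<beta> = r + r'" using r by auto
      then show "B (f - r' *\<^sub>R v) = r *\<^sub>R (f - r' *\<^sub>R v)"
        by (simp add: linear_diff[OF linB] linear_cmul[OF linB] Bf f_def[symmetric] algebra_simps)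
    qed
    define s where "s = sqrt (\<beta>\<^sup>2 + 4 * \<alpha>)"
    have s: "s * s = \<beta> * \<beta> + 4 * \<alpha>" using True by (simp add: s_def power2_eq_square)
    have "(\<beta> + s) / 2 = 0" "(\<beta> - s) / 2 = 0"
      by (rule root[of _ "(\<beta> - s) / 2"] root[of _ "(\<beta> + s) / 2"]; use s in \<open>simp add: field_simps\<close>)+
    then have "\<beta> = 0" "\<alpha> = 0" using s by auto
    then have "B f = 0" using Bf by simp
    then show ?thesis using killing_not_unipotent[OF H B frame v(1) f(1)] by (simp add: f_def)
  next
    case False
    \<comment> \<open>The complex roots are p + iq and p - iq, and \<open>e\<close> below is the
      vector for which \<open>v\<close>, \<open>e\<close> bring \<open>B\<close> into real normal
      form.\<close>
    define p where "p = \<beta> / 2"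
    define q where "q = sqrt (- \<alpha> - p\<^sup>2)"
    have q: "0 < q" "q * q = - \<alpha> - p * p"
      using False by (auto simp: q_def p_def power_divide real_sqrt_mult_self power2_eq_square)
    define e where "e = (- p / q) *\<^sub>R v + (1 / q) *\<^sub>R f"
    have f_eq: "f = p *\<^sub>R v + q *\<^sub>R e" using q by (simp add: e_def algebra_simps)
    show ?thesis
    proof (rule killing_rotation_euclidean[OF H B _ v(1) _ _ _ q(1)])
      show "(v, e) \<in> frames2" using frames2_comb[OF frame, of 1 "1/q" 0 "- p / q"] q by (simp add: e_def)
      show "e \<in> H" unfolding e_def using subH f v by (intro subspace_add subspace_mul)
      show "B v = p *\<^sub>R v + q *\<^sub>R e" using f_eq by (simp add: f_def)
      have "B e = (- p / q) *\<^sub>R f + (1 / q) *\<^sub>R (\<alpha> *\<^sub>R v + (2 * p) *\<^sub>R f)"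
        by (simp add: e_def linear_add[OF linB] linear_cmul[OF linB] linear_diff[OF linB] Bf f_def[symmetric] p_def)
      also have "\<dots> = (\<alpha> / q) *\<^sub>R v + (p / q) *\<^sub>R f"
        by (simp add: algebra_simps scaleR_add_left[symmetric] add_divide_distrib[symmetric])
      also have "\<dots> = ((\<alpha> + p * p) / q) *\<^sub>R v + (p / q * q) *\<^sub>R e"
        by (subst f_eq) (simp add: algebra_simps add_divide_distrib)
      also have "(\<alpha> + p * p) / q = - q" using q by (simp add: field_simps)
      finally show "B e = - q *\<^sub>R v + p *\<^sub>R e" using q by simp
    qed
  qed
qed

end

section \<open>First variation of the isometries between nearby planes\<close>

text \<open>The increments need not lie on a differentiable curve. Since \<open>f\<close> takes the
  same value at all points, f'(h n) is at most e |h n| eventually; dividing by \<open>s n\<close>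
  and passing to the limit bounds f'(d) by e |d| for every e > 0.\<close>

lemma directional_derivative_zero_of_sequence:
  assumes f: "(f has_derivative f') (at x)" and h: "h \<longlonglongrightarrow> 0" and s: "\<And>n. 0 < s n"
    and lim: "(\<lambda>n. (1 / s n) *\<^sub>R h n) \<longlonglongrightarrow> d" and eq: "\<And>n. f (x + h n) = f x"
  shows "f' d = 0"
proof -
  have bl: "bounded_linear f'" using f by (rule has_derivative_bounded_linear)
  have bound: "norm (f' d) \<le> e * norm d" if e: "0 < e" for e :: real
  proof -
    obtain \<delta> where \<delta>: "0 < \<delta>" "\<And>y. norm (y - x) < \<delta> \<Longrightarrow> norm (f y - f x - f' (y - x)) \<le> e * norm (y - x)"
      using f e unfolding has_derivative_at_alt by blast
    have "\<forall>\<^sub>F n in sequentially. norm (h n) < \<delta>"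
      using tendsto_norm_zero[OF h] \<delta>(1) by (rule order_tendstoD)
    then have "\<forall>\<^sub>F n in sequentially. norm (f' ((1 / s n) *\<^sub>R h n)) \<le> e * norm ((1 / s n) *\<^sub>R h n)"
    proof eventually_elim
      case (elim n)
      then have "norm (f' (h n)) \<le> e * norm (h n)" using \<delta>(2)[of "x + h n"] eq[of n] by simp
      then have "(1 / s n) * norm (f' (h n)) \<le> (1 / s n) * (e * norm (h n))"
        using s[of n] by (intro mult_left_mono) auto
      then show ?case using s[of n]
        by (simp add: linear_cmul[OF bounded_linear.linear[OF bl]] mult.left_commute)
    qed
    then show ?thesis
      by (rule tendsto_le[OF sequentially_bot _ _ , rotated 2])
        (intro tendsto_intros lim bounded_linear.tendsto[OF bl lim])+
  qed
  have "norm (f' d) \<le> 0"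
  proof (rule field_le_epsilon)
    fix e :: real assume e: "0 < e"
    have d: "0 < norm d + 1" by (simp add: add_nonneg_pos)
    have "norm (f' d) \<le> e / (norm d + 1) * norm d" by (rule bound) (use e d in simp)
    also have "\<dots> \<le> e" using e d by (simp add: field_simps)
    finally show "norm (f' d) \<le> 0 + e" by simp
  qed
  then show ?thesis by simp
qed

lemma linear_from_frame:
  fixes v w :: "'a::euclidean_space" and a b :: "'b::real_vector"
  assumes "(v, w) \<in> frames2"
  obtains L where "linear L" "L v = a" "L w = b" "\<And>x y. L (x *\<^sub>R v + y *\<^sub>R w) = x *\<^sub>R a + y *\<^sub>R b"
proof -
  have "v \<noteq> w" "independent {v, w}" using assms by (auto simp: frames2_def)
  then obtain L where L: "linear L" "\<forall>z\<in>{v, w}. L z = (if z = v then a else b)"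
    using linear_independent_extend[of "{v, w}" "\<lambda>z. if z = v then a else b"] by blast
  then have "L v = a" "L w = b" using \<open>v \<noteq> w\<close> by auto
  then show ?thesis using that[OF L(1)] by (simp add: linear_add[OF L(1)] linear_cmul[OF L(1)])
qed

lemma separating_functional:
  fixes H :: "'a::euclidean_space set"
  assumes "subspace H" "e \<notin> H"
  obtains \<epsilon> :: "'a \<Rightarrow> real" where "linear \<epsilon>" "\<epsilon> e = 1" "\<And>v. v \<in> H \<Longrightarrow> \<epsilon> v = 0"
proof -
  obtain y z where yz: "y \<in> span H" "\<And>w. w \<in> span H \<Longrightarrow> orthogonal z w" "e = y + z"
    using orthogonal_subspace_decomp_exists by blast
  have span: "span H = H" using assms(1) span_eq_iff by blast
  then have "z \<noteq> 0" using assms(2) yz(1,3) unfolding span by auto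
  moreover have "z \<bullet> e = z \<bullet> z" using yz by (auto simp: orthogonal_def inner_add_right)
  ultimately show ?thesis
    using that[of "\<lambda>v. (z \<bullet> v) / (z \<bullet> z)"] yz(2) span
    by (auto simp: orthogonal_def linear_iff inner_add_right add_divide_distrib)
qed

context minkowski_space
begin

section \<open>Isometries onto planes near a given plane, and their limits\<close>

lemma norm_comparison:
  "\<exists>m>0. \<forall>v. m * norm v \<le> \<Phi> v" "\<exists>M. \<forall>v. \<Phi> v \<le> M * norm v"
proof -
  have sph: "compact (sphere (0::'a) 1)" "sphere (0::'a) 1 \<noteq> {}" by auto
  have cont: "continuous_on (sphere (0::'a) 1) \<Phi>"
    by (rule continuous_on_subset[OF smooth_on_continuous[OF smooth_norm]]) auto
  obtain a where a: "a \<in> sphere 0 1" "\<forall>y\<in>sphere 0 1. \<Phi> a \<le> \<Phi> y"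
    using continuous_attains_inf[OF sph cont] by blast
  obtain b where b: "b \<in> sphere 0 1" "\<forall>y\<in>sphere 0 1. \<Phi> y \<le> \<Phi> b"
    using continuous_attains_sup[OF sph cont] by blast
  have both: "\<Phi> a * norm v \<le> \<Phi> v \<and> \<Phi> v \<le> \<Phi> b * norm v" for v
  proof (cases "v = 0")
    case True
    then show ?thesis by (simp add: norm_zero)
  next
    case False
    then have "(1 / norm v) *\<^sub>R v \<in> sphere 0 1" by simp
    then have "\<Phi> a \<le> \<Phi> ((1 / norm v) *\<^sub>R v)" "\<Phi> ((1 / norm v) *\<^sub>R v) \<le> \<Phi> b" using a b by blast+
    then show ?thesis using False by (simp add: norm_scale field_simps)
  qed
  have "0 < \<Phi> a" using a(1) by (auto intro!: norm_pos)
  then show "\<exists>m>0. \<forall>v. m * norm v \<le> \<Phi> v" "\<exists>M. \<forall>v. \<Phi> v \<le> M * norm v"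
    using both by blast+
qed

lemma norm_tendsto_zero: "x \<longlonglongrightarrow> 0 \<Longrightarrow> (\<lambda>n. \<Phi> (x n)) \<longlonglongrightarrow> 0"
proof -
  assume x: "x \<longlonglongrightarrow> 0"
  obtain M where M: "\<forall>v. \<Phi> v \<le> M * norm v" using norm_comparison(2) by blast
  have "(\<lambda>n. M * norm (x n)) \<longlonglongrightarrow> 0"
    using tendsto_mult_right_zero[OF tendsto_norm_zero[OF x]] .
  moreover have "norm (\<Phi> (x n)) \<le> M * norm (x n)" for n
    using M norm_nonneg[of "x n"] by simp
  ultimately show ?thesis by (rule Lim_null_comparison[OF always_eventually[OF allI], rotated])
qed

lemma norm_tendsto: "x \<longlonglongrightarrow> v \<Longrightarrow> (\<lambda>n. \<Phi> (x n)) \<longlonglongrightarrow> \<Phi> v"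
proof (cases "v = 0")
  case True
  then show "x \<longlonglongrightarrow> v \<Longrightarrow> (\<lambda>n. \<Phi> (x n)) \<longlonglongrightarrow> \<Phi> v"
    using norm_tendsto_zero norm_zero by simp
next
  case False
  then show "x \<longlonglongrightarrow> v \<Longrightarrow> (\<lambda>n. \<Phi> (x n)) \<longlonglongrightarrow> \<Phi> v"
    by (rule isCont_tendsto_compose[OF differentiable_imp_continuous_within[OF norm_differentiable]])
qed

text \<open>With \<open>\<epsilon>\<close> vanishing on \<open>H\<close>, \<open>\<epsilon> e = 1\<close> and \<open>l e = 0\<close>, the last two conditions say that \<open>L\<close>
  maps \<open>H\<close> into the graph \<open>{v + t l(v) e | v \<in> H}\<close>.\<close>

definition graph_isometry ::
    "'a set \<Rightarrow> 'a \<Rightarrow> ('a \<Rightarrow> real) \<Rightarrow> ('a \<Rightarrow> real) \<Rightarrow> real \<Rightarrow> ('a \<Rightarrow> 'a) \<Rightarrow> bool" where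
  "graph_isometry H e \<epsilon> l t L \<longleftrightarrow> linear L \<and>
     (\<forall>v\<in>H. \<Phi> (L v) = \<Phi> v \<and> \<epsilon> (L v) = t * l (L v) \<and> L v - \<epsilon> (L v) *\<^sub>R e \<in> H)"

lemma linear_tendsto_on_plane:
  assumes frame: "(e1, e2) \<in> frames2" and L: "\<And>n. linear (L n)" "linear M"
    and lim: "(\<lambda>n. L n e1) \<longlonglongrightarrow> M e1" "(\<lambda>n. L n e2) \<longlonglongrightarrow> M e2" and v: "v \<in> span {e1, e2}"
  shows "(\<lambda>n. L n v :: 'a) \<longlonglongrightarrow> M v"
proof -
  obtain x y where "v = x *\<^sub>R e1 + y *\<^sub>R e2" using v mem_span2 by blast
  moreover have "(\<lambda>n. x *\<^sub>R L n e1 + y *\<^sub>R L n e2) \<longlonglongrightarrow> x *\<^sub>R M e1 + y *\<^sub>R M e2"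
    by (intro tendsto_intros lim)
  ultimately show ?thesis using L by (simp add: linear_add linear_cmul)
qed

text \<open>The graph is spanned by the frame tilted towards \<open>e\<close>, hence belongs to
  \<open>U\<close> for small \<open>t\<close>. Because \<open>l e = 0\<close>, \<open>l\<close>
  agrees at a point of the graph and at its foot in \<open>H\<close>, so the height can be expressed
  by the image point alone.\<close>

lemma graph_isometries_exist:
  assumes U: "openin gr2_topology U" and iso: "\<And>H H'. H \<in> U \<Longrightarrow> H' \<in> U \<Longrightarrow> isometric_subspaces \<Phi> H H'"
    and frame: "(e1, e2) \<in> frames2" "span {e1, e2} \<in> U"
    and \<epsilon>: "linear \<epsilon>" "\<epsilon> e = 1" "\<And>v. v \<in> span {e1, e2} \<Longrightarrow> \<epsilon> v = 0"
    and l: "linear l" "l e = 0"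
  obtains \<eta> where "0 < \<eta>"
    "\<And>t. \<bar>t\<bar> < \<eta> \<Longrightarrow> \<exists>L. graph_isometry (span {e1, e2}) e \<epsilon> l t L"
proof -
  have "open {p \<in> frames2. frame_span p \<in> U}" using U openin_gr2_iff by blast
  moreover have "(e1, e2) \<in> {p \<in> frames2. frame_span p \<in> U}" using frame by (simp add: frame_span_def)
  ultimately obtain \<eta> where \<eta>: "0 < \<eta>"
    "\<And>t. \<bar>t\<bar> < \<eta> \<Longrightarrow> (e1, e2) + t *\<^sub>R (l e1 *\<^sub>R e, l e2 *\<^sub>R e) \<in> {p \<in> frames2. frame_span p \<in> U}"
    using open_line_ball by blast
  have "\<exists>L. graph_isometry (span {e1, e2}) e \<epsilon> l t L" if t: "\<bar>t\<bar> < \<eta>" for t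
  proof -
    define a where "a = e1 + t *\<^sub>R l e1 *\<^sub>R e"
    define b where "b = e2 + t *\<^sub>R l e2 *\<^sub>R e"
    have "span {a, b} \<in> U" using \<eta>(2)[OF t] by (simp add: a_def b_def frame_span_def)
    then obtain L where L: "linear L" "bij_betw L (span {e1, e2}) (span {a, b})"
      "\<And>v. v \<in> span {e1, e2} \<Longrightarrow> \<Phi> (L v) = \<Phi> v"
      using iso[OF frame(2)] unfolding isometric_subspaces_def by blast
    have mem: "\<epsilon> z = t * l z \<and> z - \<epsilon> z *\<^sub>R e \<in> span {e1, e2}" if z: "z \<in> span {a, b}" for z
    proof -
      obtain x y where xy: "z = x *\<^sub>R a + y *\<^sub>R b" using z mem_span2 by blast
      define v where "v = x *\<^sub>R e1 + y *\<^sub>R e2"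
      have v: "v \<in> span {e1, e2}" unfolding v_def mem_span2 by blast
      have zv: "z = v + (t * l v) *\<^sub>R e"
        by (simp add: xy v_def a_def b_def linear_add[OF l(1)] linear_cmul[OF l(1)] algebra_simps)
      have "\<epsilon> z = t * l v" "l z = l v"
        using \<epsilon>(2) \<epsilon>(3)[OF v] l(2)
        by (simp_all add: zv linear_add[OF l(1)] linear_cmul[OF l(1)] linear_add[OF \<epsilon>(1)] linear_cmul[OF \<epsilon>(1)])
      then show ?thesis using v zv by simp
    qed
    have "graph_isometry (span {e1, e2}) e \<epsilon> l t L"
      unfolding graph_isometry_def using L mem bij_betw_apply[OF L(2)] by blast
    then show ?thesis by blast
  qed
  then show ?thesis using that \<eta>(1) by blast
qed

text \<open>Positivity of \<Phi> makes \<open>M\<close> injective on \<open>H\<close>, and equality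
  of dimensions makes it onto. The inverse is needed to move a limit of isometries to the
  identity.\<close>

lemma linear_isometry_inverse_on_plane:
  assumes H: "H \<in> gr2" and M: "linear M" "M ` H \<subseteq> H" "\<And>v. v \<in> H \<Longrightarrow> \<Phi> (M v) = \<Phi> v"
  obtains g where "linear g" "\<And>v. v \<in> H \<Longrightarrow> g v \<in> H \<and> M (g v) = v"
proof -
  have subH: "subspace H" by (rule gr2_subspace[OF H])
  have inj: "inj_on M H"
  proof (rule inj_onI)
    fix x y assume xy: "x \<in> H" "y \<in> H" "M x = M y"
    then have "\<Phi> (x - y) = \<Phi> (M (x - y))" using M(3) subspace_diff[OF subH] by metis
    also have "\<dots> = 0" using xy norm_zero by (simp add: linear_diff[OF M(1)])
    finally show "x = y" using norm_pos[of "x - y"] by fastforce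
  qed
  have "M ` H = H"
  proof (rule subspace_dim_equal)
    show "dim H \<le> dim (M ` H)"
      using dim_image_eq[OF M(1)] inj subH by (metis order_refl span_eq_iff)
  qed (use M subH in \<open>auto intro: linear_subspace_image\<close>)
  moreover obtain g where g: "range g \<subseteq> H" "linear g" "\<forall>v\<in>H. g (M v) = v"
    using linear_exists_left_inverse_on[OF M(1) subH inj] by blast
  ultimately show ?thesis using that[OF g(2)] by (metis imageE rangeI subsetD)
qed

text \<open>The given isometries may stay far from the identity. They are bounded on
  \<open>H\<close>, so a subsequence converges to some \<open>M\<close>; the heights tend to 0, so
  \<open>M\<close> is an isometry of \<open>H\<close> onto itself, and composing with its inverse on
  the right leaves the target graphs unchanged.\<close>

lemma graph_isometries_near_identity:
  assumes frame: "(e1, e2) \<in> frames2" and H: "H = span {e1, e2}"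
    and \<epsilon>: "linear \<epsilon>" and l: "linear l"
    and ex: "\<And>n. graph_isometry H e \<epsilon> l (t n) (L n)" and t: "t \<longlonglongrightarrow> 0"
  obtains r L' where "strict_mono (r :: nat \<Rightarrow> nat)" "\<And>n. graph_isometry H e \<epsilon> l (t (r n)) (L' n)"
    "\<And>v. v \<in> H \<Longrightarrow> (\<lambda>n. L' n v) \<longlonglongrightarrow> v"
proof -
  have gr: "H \<in> gr2" unfolding H by (rule frame_span_in_gr2[OF frame])
  have e12: "e1 \<in> H" "e2 \<in> H" by (auto simp: H span_base)
  have linL: "linear (L n)" for n using ex by (simp add: graph_isometry_def)
  obtain m where m: "0 < m" and m': "\<forall>v. m * norm v \<le> \<Phi> v" using norm_comparison(1) by blast
  have bdd: "norm (L n v) \<le> \<Phi> v / m" if "v \<in> H" for n v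
    using m'[rule_format, of "L n v"] ex[of n] that m by (simp add: graph_isometry_def field_simps)
  have "bounded (range (\<lambda>n. (L n e1, L n e2)))"
    unfolding bounded_iff
  proof (intro exI ballI)
    fix p assume "p \<in> range (\<lambda>n. (L n e1, L n e2))"
    then obtain n where p: "p = (L n e1, L n e2)" by blast
    have "norm p \<le> norm (L n e1) + norm (L n e2)" unfolding p by (rule norm_Pair_le)
    also have "\<dots> \<le> \<Phi> e1 / m + \<Phi> e2 / m" by (intro add_mono bdd e12)
    finally show "norm p \<le> \<Phi> e1 / m + \<Phi> e2 / m" .
  qed
  then obtain c r where r: "strict_mono (r :: nat \<Rightarrow> nat)" and c: "((\<lambda>n. (L n e1, L n e2)) \<circ> r) \<longlonglongrightarrow> c"
    using bounded_imp_convergent_subsequence by blast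
  obtain M where M: "linear M" "M e1 = fst c" "M e2 = snd c"
    using linear_from_frame[OF frame] by metis
  have lim: "(\<lambda>n. L (r n) v) \<longlonglongrightarrow> M v" if "v \<in> H" for v
  proof (rule linear_tendsto_on_plane[OF frame linL M(1)])
    show "(\<lambda>n. L (r n) e1) \<longlonglongrightarrow> M e1" "(\<lambda>n. L (r n) e2) \<longlonglongrightarrow> M e2"
      using tendsto_fst[OF c] tendsto_snd[OF c] M by (simp_all add: o_def)
    show "v \<in> span {e1, e2}" using that H by simp
  qed
  have tr: "(\<lambda>n. t (r n)) \<longlonglongrightarrow> 0" using LIMSEQ_subseq_LIMSEQ[OF t r] by (simp add: o_def)
  have lin_lim: "(\<lambda>n. k (L (r n) v)) \<longlonglongrightarrow> k (M v)" if "linear k" "v \<in> H" for k :: "'a \<Rightarrow> real" and v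
    using bounded_linear.tendsto[OF linear_conv_bounded_linear[THEN iffD1, OF that(1)] lim[OF that(2)]] .
  have iso: "\<Phi> (M v) = \<Phi> v" if "v \<in> H" for v
  proof -
    have "\<Phi> (L (r n) v) = \<Phi> v" for n using ex that by (simp add: graph_isometry_def)
    then show ?thesis using norm_tendsto[OF lim[OF that]] by (simp add: LIMSEQ_const_iff)
  qed
  have closedH: "closed H" by (rule closed_subspace[OF gr2_subspace[OF gr]])
  have MH: "M v \<in> H" if v: "v \<in> H" for v
  proof -
    have "\<epsilon> (L (r n) v) = t (r n) * l (L (r n) v)" for n using ex v by (simp add: graph_isometry_def)
    moreover have "(\<lambda>n. t (r n) * l (L (r n) v)) \<longlonglongrightarrow> 0 * l (M v)"
      by (intro tendsto_intros tr lin_lim[OF l v])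
    ultimately have \<epsilon>0: "(\<lambda>n. \<epsilon> (L (r n) v)) \<longlonglongrightarrow> 0" by simp
    have "(\<lambda>n. L (r n) v - \<epsilon> (L (r n) v) *\<^sub>R e) \<longlonglongrightarrow> M v - 0 *\<^sub>R e"
      by (intro tendsto_intros lim[OF v] \<epsilon>0)
    moreover have "L (r n) v - \<epsilon> (L (r n) v) *\<^sub>R e \<in> H" for n using ex v unfolding graph_isometry_def by blast
    ultimately show ?thesis using closed_sequentially[OF closedH] by fastforce
  qed
  obtain g where g: "linear g" "\<And>v. v \<in> H \<Longrightarrow> g v \<in> H \<and> M (g v) = v"
    using linear_isometry_inverse_on_plane[OF gr M(1) _ iso] MH by blast
  have "graph_isometry H e \<epsilon> l (t (r n)) (L (r n) \<circ> g)" for n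
  proof -
    have "\<Phi> (g v) = \<Phi> v" if "v \<in> H" for v using iso[of "g v"] g(2)[OF that] by simp
    then show ?thesis
      using ex[of "r n"] g(2) linear_compose[OF g(1) linL, of "r n"]
      unfolding graph_isometry_def o_apply by metis
  qed
  moreover have "(\<lambda>n. (L (r n) \<circ> g) v) \<longlonglongrightarrow> v" if "v \<in> H" for v
    using lim[of "g v"] g(2)[OF that] by simp
  ultimately show ?thesis by (rule that[OF r])
qed

text \<open>The difference quotient \<open>(L - id) / s\<close> is normalised by \<open>s = t + \<parallel>L - id\<parallel>\<close>, so that it always
  has a nonzero limit point; \<open>\<tau>\<close> is the limit of \<open>t / s\<close>, and \<open>\<tau> = 0\<close> yields a flow of isometries of \<open>H\<close>.\<close>

lemma infinitesimal_isometry_normalised: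
  assumes frame: "(e1, e2) \<in> frames2" and H: "H = span {e1, e2}"
    and \<epsilon>: "linear \<epsilon>" "\<epsilon> e = 1" "\<And>v. v \<in> H \<Longrightarrow> \<epsilon> v = 0" and l: "linear l"
    and ex: "\<And>n. graph_isometry H e \<epsilon> l (t n) (L n)" and t: "t \<longlonglongrightarrow> 0" "\<And>n. 0 < t n"
    and near: "\<And>v. v \<in> H \<Longrightarrow> (\<lambda>n. L n v) \<longlonglongrightarrow> v"
  obtains R \<tau> where "linear R" "\<And>v. v \<in> H \<Longrightarrow> v \<noteq> 0 \<Longrightarrow> dd \<Phi> (R v) v = 0"
    "\<And>v. v \<in> H \<Longrightarrow> \<epsilon> (R v) = \<tau> * l v \<and> R v - \<epsilon> (R v) *\<^sub>R e \<in> H"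
    "\<tau> = 0 \<Longrightarrow> \<exists>v\<in>H. R v \<noteq> 0"
proof -
  have gr: "H \<in> gr2" unfolding H by (rule frame_span_in_gr2[OF frame])
  have subH: "subspace H" and closedH: "closed H"
    using gr2_subspace[OF gr] by (auto intro: closed_subspace)
  have e12: "e1 \<in> H" "e2 \<in> H" by (auto simp: H span_base)
  have linL: "linear (L n)" for n using ex by (simp add: graph_isometry_def)
  define D where "D n = (L n e1 - e1, L n e2 - e2)" for n
  define s where "s n = t n + norm (D n)" for n
  have s: "0 < s n" for n using t(2)[of n] by (simp add: s_def add_pos_nonneg)
  define q where "q n = (t n / s n, (1 / s n) *\<^sub>R D n)" for n
  have qsum: "fst (q n) + norm (snd (q n)) = 1" for n
  proof -
    have "fst (q n) + norm (snd (q n)) = (t n + norm (D n)) / s n"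
      using s[of n] by (simp add: q_def add_divide_distrib)
    also have "\<dots> = 1" using s[of n] by (simp add: s_def)
    finally show ?thesis .
  qed
  have "bounded (range q)"
    unfolding bounded_iff
  proof (intro exI ballI)
    fix p assume "p \<in> range q"
    then obtain n where p: "p = q n" by blast
    have "norm p \<le> norm (fst p) + norm (snd p)" using norm_Pair_le[of "fst p" "snd p"] by simp
    also have "\<dots> = 1" using qsum[of n] t(2)[of n] s[of n] by (simp add: p q_def)
    finally show "norm p \<le> 1" .
  qed
  then obtain c r where r: "strict_mono (r :: nat \<Rightarrow> nat)" and c: "(q \<circ> r) \<longlonglongrightarrow> c"
    using bounded_imp_convergent_subsequence by blast
  define \<tau> where "\<tau> = fst c"
  obtain R where R: "linear R" "R e1 = fst (snd c)" "R e2 = snd (snd c)"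
    using linear_from_frame[OF frame] by metis
  have lim\<tau>: "(\<lambda>n. t (r n) / s (r n)) \<longlonglongrightarrow> \<tau>"
    using tendsto_fst[OF c] by (simp add: \<tau>_def q_def o_def)
  have limD: "(\<lambda>n. (1 / s (r n)) *\<^sub>R D (r n)) \<longlonglongrightarrow> snd c"
    using tendsto_snd[OF c] by (simp add: q_def o_def)
  have limR: "(\<lambda>n. (1 / s (r n)) *\<^sub>R (L (r n) v - v)) \<longlonglongrightarrow> R v" if "v \<in> H" for v
  proof (rule linear_tendsto_on_plane[OF frame _ R(1), of "\<lambda>n v. (1 / s (r n)) *\<^sub>R (L (r n) v - v)"])
    show "linear (\<lambda>v. (1 / s (r n)) *\<^sub>R (L (r n) v - v))" for n
      by (intro linear_compose_scale_right linear_compose_sub linL linear_ident)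
    show "(\<lambda>n. (1 / s (r n)) *\<^sub>R (L (r n) e1 - e1)) \<longlonglongrightarrow> R e1"
      "(\<lambda>n. (1 / s (r n)) *\<^sub>R (L (r n) e2 - e2)) \<longlonglongrightarrow> R e2"
      using tendsto_fst[OF limD] tendsto_snd[OF limD] R by (auto simp: D_def)
    show "v \<in> span {e1, e2}" using that H by simp
  qed
  have near': "(\<lambda>n. L (r n) v) \<longlonglongrightarrow> v" if "v \<in> H" for v
    using LIMSEQ_subseq_LIMSEQ[OF near[OF that] r] by (simp add: o_def)
  have lin_lim: "(\<lambda>n. k (x n)) \<longlonglongrightarrow> k y" if "linear k" "x \<longlonglongrightarrow> y" for k :: "'a \<Rightarrow> real" and x y
    using bounded_linear.tendsto[OF linear_conv_bounded_linear[THEN iffD1, OF that(1)] that(2)] .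
  have 1: "dd \<Phi> (R v) v = 0" if v: "v \<in> H" "v \<noteq> 0" for v
  proof (rule directional_derivative_zero_of_sequence[OF dd_has_derivative[OF norm_differentiable[OF v(2)]]
        _ _ limR[OF v(1)]])
    show "(\<lambda>n. L (r n) v - v) \<longlonglongrightarrow> 0" using LIM_zero[OF near'[OF v(1)]] .
    show "0 < s (r n)" for n by (rule s)
    show "\<Phi> (v + (L (r n) v - v)) = \<Phi> v" for n using ex v by (simp add: graph_isometry_def)
  qed
  have 2: "\<epsilon> (R v) = \<tau> * l v" if v: "v \<in> H" for v
  proof -
    have "(\<lambda>n. t (r n) / s (r n) * l (L (r n) v)) \<longlonglongrightarrow> \<tau> * l v"
      by (intro tendsto_intros lim\<tau> lin_lim[OF l near'[OF v]])
    moreover have "\<epsilon> ((1 / s (r n)) *\<^sub>R (L (r n) v - v)) = t (r n) / s (r n) * l (L (r n) v)" for n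
      using ex[of "r n"] v \<epsilon>(3)[OF v]
      by (simp add: graph_isometry_def linear_cmul[OF \<epsilon>(1)] linear_diff[OF \<epsilon>(1)])
    ultimately show ?thesis using lin_lim[OF \<epsilon>(1) limR[OF v]] LIMSEQ_unique by fastforce
  qed
  have 3: "R v - \<epsilon> (R v) *\<^sub>R e \<in> H" if v: "v \<in> H" for v
  proof (rule closed_sequentially[OF closedH])
    show "(\<lambda>n. (1 / s (r n)) *\<^sub>R (L (r n) v - v) - \<epsilon> ((1 / s (r n)) *\<^sub>R (L (r n) v - v)) *\<^sub>R e)
        \<longlonglongrightarrow> R v - \<epsilon> (R v) *\<^sub>R e"
      by (intro tendsto_intros limR[OF v] lin_lim[OF \<epsilon>(1)])
    show "(1 / s (r n)) *\<^sub>R (L (r n) v - v) - \<epsilon> ((1 / s (r n)) *\<^sub>R (L (r n) v - v)) *\<^sub>R e \<in> H" for n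
    proof -
      have "L (r n) v - \<epsilon> (L (r n) v) *\<^sub>R e \<in> H" using ex v unfolding graph_isometry_def by blast
      then have "(1 / s (r n)) *\<^sub>R ((L (r n) v - \<epsilon> (L (r n) v) *\<^sub>R e) - v) \<in> H"
        using v by (intro subspace_mul[OF subH] subspace_diff[OF subH, of _ v])
      then show ?thesis
        using \<epsilon>(3)[OF v] by (simp add: linear_cmul[OF \<epsilon>(1)] linear_diff[OF \<epsilon>(1)] algebra_simps)
    qed
  qed
  \<comment> \<open>The normalisation by \<open>s\<close> survives the limit: \<tau> plus the norm
    of the limiting quotient is 1, so they cannot both vanish.\<close>
  have 4: "\<exists>v\<in>H. R v \<noteq> 0" if "\<tau> = 0"
  proof (rule ccontr)
    assume "\<not> (\<exists>v\<in>H. R v \<noteq> 0)"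
    then have "snd c = 0" using R e12 by (simp add: prod_eq_iff)
    have "(\<lambda>n. fst ((q \<circ> r) n) + norm (snd ((q \<circ> r) n))) \<longlonglongrightarrow> fst c + norm (snd c)"
      by (intro tendsto_intros c)
    then have "(\<lambda>n::nat. 1::real) \<longlonglongrightarrow> 0" using that \<open>snd c = 0\<close> by (simp add: qsum \<tau>_def)
    then show False by (simp add: LIMSEQ_const_iff)
  qed
  show ?thesis by (rule that[OF R(1) 1 _ 4]) (use 2 3 in blast)+
qed

lemma infinitesimal_isometry:
  assumes U: "openin gr2_topology U" and iso: "\<And>H H'. H \<in> U \<Longrightarrow> H' \<in> U \<Longrightarrow> isometric_subspaces \<Phi> H H'"
    and frame: "(e1, e2) \<in> frames2" "H = span {e1, e2}" and H: "H \<in> U" and e: "e \<notin> H" and l: "linear l"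
    and no_killing: "\<forall>B. killing_on H B \<longrightarrow> (\<forall>v\<in>H. B v = 0)"
  obtains A where "linear A" "A ` H \<subseteq> H" "\<And>v. v \<in> H \<Longrightarrow> v \<noteq> 0 \<Longrightarrow> dd \<Phi> (A v + l v *\<^sub>R e) v = 0"
proof -
  have subH: "subspace H" using frame by simp
  obtain \<epsilon> where \<epsilon>: "linear \<epsilon>" "\<epsilon> e = (1::real)" "\<And>v. v \<in> H \<Longrightarrow> \<epsilon> v = 0"
    using separating_functional[OF subH e] by blast
  \<comment> \<open>The graph description requires a functional vanishing at \<open>e\<close>;
    subtracting a multiple of \<epsilon> achieves this without changing \<open>l\<close> on
    \<open>H\<close>.\<close>
  define k where "k v = l v - l e * \<epsilon> v" for v
  have k: "linear k" "k e = 0" "\<And>v. v \<in> H \<Longrightarrow> k v = l v"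
    using l \<epsilon> by (auto simp: k_def linear_iff algebra_simps)
  obtain \<eta> where \<eta>: "0 < \<eta>" "\<And>t. \<bar>t\<bar> < \<eta> \<Longrightarrow> \<exists>L. graph_isometry H e \<epsilon> k t L"
    using graph_isometries_exist[OF U iso frame(1) _ \<epsilon>(1,2) _ k(1,2)] frame(2) H \<epsilon>(3) by blast
  define t where "t n = \<eta> / 2 * inverse (real (Suc n))" for n
  have t0: "0 < t n" for n using \<eta>(1) by (simp add: t_def)
  have t1: "\<bar>t n\<bar> < \<eta>" for n
  proof -
    have "inverse (real (Suc n)) \<le> 1" by (simp add: inverse_le_1_iff)
    then have "t n \<le> \<eta> / 2 * 1" unfolding t_def using \<eta>(1) by (intro mult_left_mono) auto
    then show ?thesis using \<eta>(1) t0[of n] by simp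
  qed
  have tlim: "t \<longlonglongrightarrow> 0"
    unfolding t_def using tendsto_mult_right_zero[OF LIMSEQ_inverse_real_of_nat] .
  obtain L where "\<And>n. graph_isometry H e \<epsilon> k (t n) (L n)" using \<eta>(2)[OF t1] by metis
  then obtain r L' where r: "strict_mono (r :: nat \<Rightarrow> nat)" "\<And>n. graph_isometry H e \<epsilon> k (t (r n)) (L' n)"
      "\<And>v. v \<in> H \<Longrightarrow> (\<lambda>n. L' n v) \<longlonglongrightarrow> v"
    using graph_isometries_near_identity[OF frame \<epsilon>(1) k(1) _ tlim] by blast
  have "(\<lambda>n. t (r n)) \<longlonglongrightarrow> 0" using LIMSEQ_subseq_LIMSEQ[OF tlim r(1)] by (simp add: o_def)
  from infinitesimal_isometry_normalised[OF frame \<epsilon> k(1) r(2) this t0 r(3)]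
  obtain R \<tau> where R: "linear R" "\<And>v. v \<in> H \<Longrightarrow> v \<noteq> 0 \<Longrightarrow> dd \<Phi> (R v) v = 0"
    "\<And>v. v \<in> H \<Longrightarrow> \<epsilon> (R v) = \<tau> * k v \<and> R v - \<epsilon> (R v) *\<^sub>R e \<in> H" "\<tau> = 0 \<Longrightarrow> \<exists>v\<in>H. R v \<noteq> 0"
    by blast
  \<comment> \<open>For \<tau> = 0 the limit \<open>R\<close> would map \<open>H\<close> into itself
    and be a nonzero infinitesimal isometry. Otherwise the component of \<open>R\<close> in
    \<open>H\<close>, divided by \<tau>, is the required endomorphism.\<close>
  have \<tau>: "\<tau> \<noteq> 0"
  proof
    assume \<tau>: "\<tau> = 0"
    then have "killing_on H R" using R(1-3) by (force simp: killing_on_def)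
    then show False using no_killing R(4)[OF \<tau>] by blast
  qed
  show ?thesis
  proof (rule that)
    show "linear (\<lambda>v. (1 / \<tau>) *\<^sub>R (R v - \<epsilon> (R v) *\<^sub>R e))"
      using R(1) \<epsilon>(1) by (auto simp: linear_iff algebra_simps add_divide_distrib)
    show "(\<lambda>v. (1 / \<tau>) *\<^sub>R (R v - \<epsilon> (R v) *\<^sub>R e)) ` H \<subseteq> H"
      using R(3) subspace_mul[OF subH] by blast
    fix v assume v: "v \<in> H" "v \<noteq> 0"
    have "(1 / \<tau>) *\<^sub>R (R v - \<epsilon> (R v) *\<^sub>R e) + l v *\<^sub>R e = (1 / \<tau>) *\<^sub>R R v"
      using R(3)[OF v(1)] k(3)[OF v(1)] \<tau> by (simp add: algebra_simps)
    then show "dd \<Phi> ((1 / \<tau>) *\<^sub>R (R v - \<epsilon> (R v) *\<^sub>R e) + l v *\<^sub>R e) v = 0"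
      using R(2)[OF v] linear_cmul[OF dd_norm_linear[OF v(2)], of "1 / \<tau>" "R v"] by simp
  qed
qed

section \<open>From first variations to a supporting cylinder\<close>

lemma coordinates_from_frame:
  assumes "(v, w) \<in> frames2"
  obtains X Y :: "'a \<Rightarrow> real" where "linear X" "linear Y"
    "\<And>x y. X (x *\<^sub>R v + y *\<^sub>R w) = x" "\<And>x y. Y (x *\<^sub>R v + y *\<^sub>R w) = y"
proof -
  obtain X :: "'a \<Rightarrow> real" where X: "linear X" "X v = 1" "X w = 0"
    using linear_from_frame[OF assms, of "1::real" 0] by metis
  obtain Y :: "'a \<Rightarrow> real" where Y: "linear Y" "Y v = 0" "Y w = 1"
    using linear_from_frame[OF assms, of "0::real" 1] by metis
  show ?thesis
    by (rule that[OF X(1) Y(1)])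
      (simp_all add: linear_add[OF X(1)] linear_cmul[OF X(1)] linear_add[OF Y(1)] linear_cmul[OF Y(1)] X Y)
qed

lemma odd_has_zero:
  fixes K :: "real \<Rightarrow> real"
  assumes "continuous_on UNIV K" "\<And>\<theta>. K (\<theta> + pi) = - K \<theta>"
  obtains \<theta> where "K \<theta> = 0"
proof -
  have c: "\<forall>x. 0 \<le> x \<and> x \<le> pi \<longrightarrow> isCont K x"
    using assms(1) by (simp add: continuous_on_eq_continuous_at)
  have "K pi = - K 0" using assms(2)[of 0] by simp
  then show ?thesis
    using IVT[of K 0 0 pi] IVT2[of K pi 0 0] c that pi_ge_zero by (cases "K 0 \<le> 0") auto
qed

text \<open>If \<open>A\<^sub>\<lambda>\<close> corresponds to the functional \<open>\<lambda>\<close>, then \<open>v \<mapsto> det (v, A\<^sub>\<lambda> v)\<close> with \<open>\<lambda>\<close> vanishing at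
  \<open>v\<close> is a cubic form, so it has a zero \<open>v\<^sub>0\<close>; there \<open>A\<^sub>\<lambda> v\<^sub>0\<close> is a multiple of \<open>v\<^sub>0\<close> and hence \<open>0\<close>.
  Thus \<open>A\<^sub>\<lambda> = \<lambda> \<otimes> w\<close>, and dividing by \<open>\<lambda>\<close> gives the cylinder.\<close>

lemma cylinder_if_no_killing:
  assumes U: "openin gr2_topology U" and iso: "\<And>H H'. H \<in> U \<Longrightarrow> H' \<in> U \<Longrightarrow> isometric_subspaces \<Phi> H H'"
    and H: "H \<in> U" and no_killing: "\<forall>B. killing_on H B \<longrightarrow> (\<forall>v\<in>H. B v = 0)"
  shows "cylinder_along H"
  unfolding cylinder_along_def
proof (intro allI impI)
  fix e assume e: "e \<notin> H"
  have gr: "H \<in> gr2" using U H by (auto simp: openin_gr2_topology)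
  have subH: "subspace H" by (rule gr2_subspace[OF gr])
  obtain e1 e2 where frame: "(e1, e2) \<in> frames2" "H = span {e1, e2}" using gr2_obtain_frame[OF gr] by blast
  have in_H: "x *\<^sub>R e1 + y *\<^sub>R e2 \<in> H" for x y unfolding frame(2) mem_span2 by blast
  obtain X Y :: "'a \<Rightarrow> real" where XY: "linear X" "linear Y"
    "\<And>x y. X (x *\<^sub>R e1 + y *\<^sub>R e2) = x" "\<And>x y. Y (x *\<^sub>R e1 + y *\<^sub>R e2) = y"
    using coordinates_from_frame[OF frame(1)] by blast
  have coords: "z = X z *\<^sub>R e1 + Y z *\<^sub>R e2" if "z \<in> H" for z
    using that XY(3,4) unfolding frame(2) mem_span2 by auto
  obtain A1 where A1: "linear A1" "A1 ` H \<subseteq> H" "\<And>v. v \<in> H \<Longrightarrow> v \<noteq> 0 \<Longrightarrow> dd \<Phi> (A1 v + X v *\<^sub>R e) v = 0"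
    using infinitesimal_isometry[OF U iso frame H e XY(1) no_killing] by blast
  obtain A2 where A2: "linear A2" "A2 ` H \<subseteq> H" "\<And>v. v \<in> H \<Longrightarrow> v \<noteq> 0 \<Longrightarrow> dd \<Phi> (A2 v + Y v *\<^sub>R e) v = 0"
    using infinitesimal_isometry[OF U iso frame H e XY(2) no_killing] by blast
  define \<rho> where "\<rho> \<theta> = cos \<theta> *\<^sub>R e1 + sin \<theta> *\<^sub>R e2" for \<theta>
  \<comment> \<open>\<open>W \<theta>\<close> belongs to the functional \<lambda> = cos \<theta> Y -
    sin \<theta> X, which vanishes at \<open>\<rho> \<theta>\<close>.\<close>
  define W where "W \<theta> v = (- sin \<theta>) *\<^sub>R A1 v + cos \<theta> *\<^sub>R A2 v" for \<theta> v
  \<comment> \<open>The determinant of \<open>W \<theta> (\<rho> \<theta>)\<close> and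
    \<open>\<rho> \<theta>\<close> in the coordinates X, Y. A half turn reverses both
    \<open>W\<close> and \<rho>, so the first column is unchanged and the second changes
    sign.\<close>
  define K where "K \<theta> = X (W \<theta> (\<rho> \<theta>)) * sin \<theta> - Y (W \<theta> (\<rho> \<theta>)) * cos \<theta>" for \<theta>
  have linW: "linear (W \<theta>)" for \<theta>
    unfolding W_def by (intro linear_compose_add linear_compose_scale_right A1 A2)
  have WH: "W \<theta> v \<in> H" if "v \<in> H" for \<theta> v
    unfolding W_def using that A1(2) A2(2) by (intro subspace_add[OF subH] subspace_mul[OF subH]) auto
  have W: "dd \<Phi> (W \<theta> v + (cos \<theta> * Y v - sin \<theta> * X v) *\<^sub>R e) v = 0" if v: "v \<in> H" "v \<noteq> 0" for \<theta> v
  proof -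
    have eq: "W \<theta> v + (cos \<theta> * Y v - sin \<theta> * X v) *\<^sub>R e =
        (- sin \<theta>) *\<^sub>R (A1 v + X v *\<^sub>R e) + cos \<theta> *\<^sub>R (A2 v + Y v *\<^sub>R e)"
      by (simp add: W_def algebra_simps)
    show ?thesis
      using A1(3)[OF v] A2(3)[OF v]
      unfolding eq linear_add[OF dd_norm_linear[OF v(2)]] linear_cmul[OF dd_norm_linear[OF v(2)]]
      by simp
  qed
  have lin_cont: "continuous_on UNIV (\<lambda>\<theta>. k (W \<theta> (\<rho> \<theta>)))" if k: "linear k" for k :: "'a \<Rightarrow> real"
    unfolding W_def \<rho>_def linear_add[OF k] linear_cmul[OF k] linear_add[OF A1(1)] linear_cmul[OF A1(1)]
      linear_add[OF A2(1)] linear_cmul[OF A2(1)]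
    by (intro continuous_intros)
  have "continuous_on UNIV K"
    unfolding K_def by (intro continuous_intros lin_cont XY)
  moreover have "K (\<theta> + pi) = - K \<theta>" for \<theta>
  proof -
    have "\<rho> (\<theta> + pi) = (-1) *\<^sub>R \<rho> \<theta>" by (simp add: \<rho>_def algebra_simps)
    moreover have "W (\<theta> + pi) v = (-1) *\<^sub>R W \<theta> v" for v by (simp add: W_def algebra_simps)
    ultimately have "W (\<theta> + pi) (\<rho> (\<theta> + pi)) = W \<theta> (\<rho> \<theta>)"
      by (simp only: linear_cmul[OF linW]) simp
    then show ?thesis by (simp add: K_def)
  qed
  ultimately obtain \<theta> where K: "K \<theta> = 0" using odd_has_zero by blast
  define v0 where "v0 = \<rho> \<theta>"
  define u0 where "u0 = (- sin \<theta>) *\<^sub>R e1 + cos \<theta> *\<^sub>R e2"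
  have cs: "cos \<theta> * cos \<theta> + sin \<theta> * sin \<theta> = 1"
    using sin_cos_squared_add2[of \<theta>] by (simp add: power2_eq_square)
  have frame0: "(v0, u0) \<in> frames2"
    unfolding v0_def u0_def \<rho>_def by (rule frames2_comb[OF frame(1)]) (use cs in simp)
  have in0: "v0 \<in> H" "u0 \<in> H" unfolding v0_def u0_def \<rho>_def by (rule in_H)+
  have nz0: "v0 \<noteq> 0" using frames2_nonzero[OF frame0] by simp
  have Xv: "X v0 = cos \<theta>" "Y v0 = sin \<theta>" "X u0 = - sin \<theta>" "Y u0 = cos \<theta>"
    unfolding v0_def u0_def \<rho>_def XY by simp_all
  \<comment> \<open>The vanishing determinant gives \<open>W \<theta> v0 = c *\<^sub>R v0\<close>.
    As \<lambda> vanishes at \<open>v0\<close>, the variation there has no \<open>e\<close> term,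
    and Euler's relation yields c = 0.\<close>
  have "W \<theta> v0 = 0"
  proof -
    define a where "a = X (W \<theta> v0)"
    define b where "b = Y (W \<theta> v0)"
    define c where "c = a * cos \<theta> + b * sin \<theta>"
    have ab: "a * sin \<theta> = b * cos \<theta>" using K by (simp add: K_def a_def b_def v0_def)
    have "c * cos \<theta> = a * (cos \<theta> * cos \<theta>) + (b * cos \<theta>) * sin \<theta>" by (simp add: c_def algebra_simps)
    also have "\<dots> = a * (cos \<theta> * cos \<theta> + sin \<theta> * sin \<theta>)" unfolding ab[symmetric] by (simp only: distrib_left mult.assoc)
    finally have ca: "c * cos \<theta> = a" unfolding cs by simp
    have "c * sin \<theta> = (a * sin \<theta>) * cos \<theta> + b * (sin \<theta> * sin \<theta>)" by (simp add: c_def algebra_simps)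
    also have "\<dots> = b * (cos \<theta> * cos \<theta> + sin \<theta> * sin \<theta>)" unfolding ab by (simp only: distrib_left mult.assoc)
    finally have cb: "c * sin \<theta> = b" unfolding cs by simp
    have "W \<theta> v0 = a *\<^sub>R e1 + b *\<^sub>R e2"
      unfolding a_def b_def by (rule coords[OF WH[OF in0(1)]])
    also have "\<dots> = c *\<^sub>R v0"
      unfolding v0_def \<rho>_def scaleR_add_right scaleR_scaleR ca cb ..
    finally have Wc: "W \<theta> v0 = c *\<^sub>R v0" .
    have "dd \<Phi> (c *\<^sub>R v0) v0 = 0" using W[OF in0(1) nz0, of \<theta>] by (simp add: Xv Wc)
    then have "c * \<Phi> v0 = 0"
      using linear_cmul[OF dd_norm_linear[OF nz0], of c v0] dd_norm_self[OF nz0] by simp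
    then show ?thesis using norm_pos[OF nz0] Wc by simp
  qed
  \<comment> \<open>\<open>W \<theta>\<close> annihilates \<open>v0\<close> and \<lambda>(u0) = 1,
    so on \<open>H\<close> it is \<lambda> tensor \<open>w\<close>.\<close>
  define w where "w = W \<theta> u0"
  have off_axis: "dd \<Phi> (e + w) (x *\<^sub>R v0 + y *\<^sub>R u0) = 0" if y: "y \<noteq> 0" for x y
  proof -
    define z where "z = x *\<^sub>R v0 + y *\<^sub>R u0"
    have z: "z \<in> H" "z \<noteq> 0"
      using in0 subspace_add[OF subH] subspace_mul[OF subH] frames2_coords[OF frame0, of x y] y
      by (auto simp: z_def)
    have "W \<theta> z = y *\<^sub>R w" using \<open>W \<theta> v0 = 0\<close> by (simp add: z_def linear_add[OF linW] linear_cmul[OF linW] w_def)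
    moreover have "cos \<theta> * Y z - sin \<theta> * X z = y"
    proof -
      have "cos \<theta> * Y z - sin \<theta> * X z = y * (cos \<theta> * cos \<theta> + sin \<theta> * sin \<theta>)"
        unfolding z_def linear_add[OF XY(1)] linear_add[OF XY(2)] linear_cmul[OF XY(1)] linear_cmul[OF XY(2)] Xv
        real_scaleR_def by algebra
      then show ?thesis unfolding cs by simp
    qed
    ultimately have "dd \<Phi> (y *\<^sub>R (e + w)) z = 0"
      using W[OF z, of \<theta>] by (simp add: algebra_simps)
    then show ?thesis
      using linear_cmul[OF dd_norm_linear[OF z(2)], of y "e + w"] y by (simp add: z_def)
  qed
  have "dd F (e + w) z = 0" if z: "z \<in> H" "z \<noteq> 0" for z
  proof -
    obtain x y where xy: "z = x *\<^sub>R v0 + y *\<^sub>R u0"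
      using z(1) frame_span_eq[OF gr frame0 in0] mem_span2 by blast
    have "dd \<Phi> (e + w) z = 0"
    proof (cases "y = 0")
      case False
      then show ?thesis using off_axis xy by simp
    next
      case True
      \<comment> \<open>On the line through \<open>v0\<close> the functional \<lambda> vanishes and
        cannot be divided out; the relation extends there by continuity of the derivative of
        \<Phi>.\<close>
      define s where "s n = inverse (real (Suc n))" for n
      have "(\<lambda>n. x *\<^sub>R v0 + s n *\<^sub>R u0) \<longlonglongrightarrow> x *\<^sub>R v0 + 0 *\<^sub>R u0"
        unfolding s_def by (intro tendsto_intros LIMSEQ_inverse_real_of_nat)
      then have lim: "(\<lambda>n. x *\<^sub>R v0 + s n *\<^sub>R u0) \<longlonglongrightarrow> z" using xy True by simp
      have "dd \<Phi> (e + w) differentiable (at z)"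
        using smooth_on_differentiable[OF smooth_on_dd[OF smooth_norm]] z(2) by simp
      then have "isCont (dd \<Phi> (e + w)) z" by (rule differentiable_imp_continuous_within)
      from isCont_tendsto_compose[OF this lim]
      have "(\<lambda>n. dd \<Phi> (e + w) (x *\<^sub>R v0 + s n *\<^sub>R u0)) \<longlonglongrightarrow> dd \<Phi> (e + w) z" .
      moreover have "dd \<Phi> (e + w) (x *\<^sub>R v0 + s n *\<^sub>R u0) = 0" for n
        by (rule off_axis) (simp add: s_def)
      ultimately show ?thesis by (simp add: LIMSEQ_const_iff)
    qed
    then show ?thesis by (simp add: dd_F[OF z(2)])
  qed
  moreover have "w \<in> H" unfolding w_def by (rule WH[OF in0(2)])
  ultimately show "\<exists>w\<in>H. \<forall>x\<in>H. x \<noteq> 0 \<longrightarrow> dd F (e + w) x = 0" by blast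
qed

end

text \<open>The inner product is pulled back by the isometry. In contrapositive form this spreads
  the failure at one plane to the whole family.\<close>

lemma euclidean_norm_on_isometric:
  assumes iso: "isometric_subspaces \<Phi> H' H" and eucl: "euclidean_norm_on H \<Phi>" and H': "subspace H'"
  shows "euclidean_norm_on H' \<Phi>"
proof -
  obtain L where L: "linear L" "bij_betw L H' H" "\<forall>v\<in>H'. \<Phi> (L v) = \<Phi> v"
    using iso by (auto simp: isometric_subspaces_def)
  obtain b where b: "inner_product_on H b" "\<forall>v\<in>H. \<Phi> v = sqrt (b v v)"
    using eucl by (auto simp: euclidean_norm_on_def)
  have LH: "L x \<in> H" if "x \<in> H'" for x using L(2) that by (rule bij_betw_apply)
  have inj: "L x \<noteq> 0" if "x \<in> H'" "x \<noteq> 0" for x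
  proof -
    have "L x \<noteq> L 0"
      using L(2) that subspace_0[OF H'] unfolding bij_betw_def by (metis inj_onD)
    then show ?thesis using linear_0[OF L(1)] by simp
  qed
  have "inner_product_on H' (\<lambda>x y. b (L x) (L y))"
    using b(1) LH inj unfolding inner_product_on_def linear_add[OF L(1)] linear_cmul[OF L(1)] by simp
  then show ?thesis unfolding euclidean_norm_on_def using b(2) L(3) LH by metis
qed

theorem theorem1:
  fixes \<Phi> :: "'a::euclidean_space \<Rightarrow> real"
    and U :: "'a set set"
  assumes "DIM('a) \<ge> 3"
    and "banach_minkowski_norm \<Phi>"
    and "openin gr2_topology U"
    and "connectedin gr2_topology U"
    and "\<And>H H'. H \<in> U \<Longrightarrow> H' \<in> U \<Longrightarrow> isometric_subspaces \<Phi> H H'"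
  shows "(\<forall>H\<in>U. euclidean_norm_on H \<Phi>) \<and>
         (\<exists>\<Psi>. euclidean_norm_on UNIV \<Psi> \<and> (\<forall>H\<in>U. \<forall>v\<in>H. \<Psi> v = \<Phi> v))"
proof -
  interpret minkowski_space \<Phi> by unfold_locales (rule assms(2))
  have gr: "H \<in> gr2" if "H \<in> U" for H using assms(3) that by (auto simp: openin_gr2_topology)
  have eucl: "euclidean_norm_on H \<Phi>" if H: "H \<in> U" for H
  proof (rule ccontr)
    assume not: "\<not> euclidean_norm_on H \<Phi>"
    \<comment> \<open>A single non-Euclidean plane makes all planes of \<open>U\<close>
      non-Euclidean, so none of them has a nonzero infinitesimal isometry. The cylinders then exist
      over the whole open set, as the tilting argument requires, and make \<open>H\<close> Euclidean
      after all.\<close>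
    have "cylinder_along K" if K: "K \<in> U" for K
    proof (intro cylinder_if_no_killing[OF assms(3,5) K] allI impI ballI)
      fix B v assume "killing_on K B" "v \<in> K"
      moreover have "\<not> euclidean_norm_on K \<Phi>"
        using euclidean_norm_on_isometric[OF assms(5)[OF H K] _ gr2_subspace[OF gr[OF H]]] not by blast
      ultimately show "B v = 0" using killing_euclidean[OF gr[OF K]] by blast
    qed
    then show False using euclidean_if_cylinders[OF assms(1,3) _ H] not by blast
  qed
  then show ?thesis using euclidean_extension[OF assms(3,4)] by blast
qed

end
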